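(* Let $\boldsymbol{X}=\boldsymbol{V}_h\times Q_h$, $\zeta=\sqrt{\lambda+2\mu/d}$, and let $$\mathcal{A}=\begin{pmatrix}A_{\boldsymbol{u}}&\alpha B^T\\-\alpha B&\tau A_p+\eta h^2L_p\end{pmatrix},\quad \mathcal{B}_L=\begin{pmatrix}A_{\boldsymbol{u}}&0\\-\alpha B&\tau A_p+\eta h^2L_p+\frac{\alpha^2}{\zeta^2}M\end{pmatrix}^{-1},\quad \mathcal{B}_D=\begin{pmatrix}A_{\boldsymbol{u}}&0\\0&\tau A_p+\eta h^2L_p+\frac{\alpha^2}{\zeta^2}M\end{pmatrix}^{-1}.$$ Suppose that $\eta=\delta\frac{\alpha^2}{\zeta^2}$ with $\delta>0$. Then there exist positive constants $\Sigma$ and $\Upsilon$, independent of discretization or physical parameters, such that, for any $\boldsymbol{x}=(\boldsymbol{u},p)^T\in\boldsymbol{X}$ with $\boldsymbol{x}\ne\boldsymbol{0}$, $$\Sigma\le\frac{(\mathcal{B}_L\mathcal{A}\boldsymbol{x},\boldsymbol{x})_{(\mathcal{B}_D)^{-1}}}{(\boldsymbol{x},\boldsymbol{x})_{(\mathcal{B}_D)^{-1}}},\qquad \frac{\|\mathcal{B}_L\mathcal{A}\boldsymbol{x}\|_{(\mathcal{B}_D)^{-1}}}{\|\boldsymbol{x}\|_{(\mathcal{B}_D)^{-1}}}\le\Upsilon.$$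
   Context: Setting. $\Omega\subset\mathbb{R}^d$, $d\in\{2,3\}$, is a bounded open set with regular boundary. Physical parameters: Lamé coefficients $\lambda\ge 0$, $\mu>0$; Biot–Willis constant $\alpha>0$; hydraulic conductivity $K>0$. Discretization parameters: mesh size $h>0$, time step size $\tau>0$. $(\cdot,\cdot)$ and $\|\cdot\|$ are the $L^2(\Omega)$ inner product and norm (also used for the duality pairing between a finite-dimensional space and its dual), $\|\cdot\|_1$ is the $H^1(\Omega)$ norm, and $\varepsilon(\boldsymbol{u})=\frac12(\nabla\boldsymbol{u}+\nabla\boldsymbol{u}^t)$. Bilinear forms: $a(\boldsymbol{u},\boldsymbol{v})=2\mu\int_\Omega\varepsilon(\boldsymbol{u}):\varepsilon(\boldsymbol{v})+\lambda\int_\Omega\operatorname{div}\boldsymbol{u}\,\operatorname{div}\boldsymbol{v}$ and $a_p(p,q)=\int_\Omega K\nabla p\cdot\nabla q$. Finite-element spaces: $\boldsymbol{V}_h\subset\boldsymbol{H}^1_0(\Omega)=H_0^1(\Omega)^d$ and $Q_h\subset H^1_0(\Omega)$ are the finite-element spaces for displacement and pressure given by the $\mathbb{P}_1$-$\mathbb{P}_1$ pair or the Mini element on a mesh of size $h$. The pair is taken to satisfy the weak inf-sup condition $$\sup_{0\ne\boldsymbol{v}\in\boldsymbol{V}_h}\frac{(\operatorname{div}\boldsymbol{v},q)}{\|\boldsymbol{v}\|_1}\ge\gamma_B^0\|q\|-\xi^0h\|\nabla q\|\qquad\text{for all }q\in Q_h,$$ with constants $\gamma_B^0>0$, $\xi^0\ge0$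 that do not depend on $h$ ($\xi^0=0$ for the Mini element). Discrete operators: $A_{\boldsymbol{u}}:\boldsymbol{V}_h\to\boldsymbol{V}_h'$, $B:\boldsymbol{V}_h\to Q_h'$, $A_p,L_p,M:Q_h\to Q_h'$ are defined by $(A_{\boldsymbol{u}}\boldsymbol{u},\boldsymbol{v})=a(\boldsymbol{u},\boldsymbol{v})$, $(B\boldsymbol{u},q)=-(\operatorname{div}\boldsymbol{u},q)$, $(A_pp,q)=a_p(p,q)$, $(L_pp,q)=(\nabla p,\nabla q)$, $(Mp,q)=\int_\Omega pq$ (pressure mass operator); $B^T:Q_h\to\boldsymbol{V}_h'$ is the adjoint of $B$. Here $\mathcal{A}:\boldsymbol{X}\to\boldsymbol{X}'$ is the operator of the stabilized discrete Biot system with its second equation negated, and $\eta$ is the stabilization parameter. Inner product: for symmetric positive definite $\mathcal{N}:\boldsymbol{X}'\to\boldsymbol{X}$, $(\boldsymbol{x},\boldsymbol{y})_{\mathcal{N}^{-1}}=\langle\mathcal{N}^{-1}\boldsymbol{x},\boldsymbol{y}\rangle$ and $\|\boldsymbol{x}\|_{\mathcal{N}^{-1}}^2=(\boldsymbol{x},\boldsymbol{x})_{\mathcal{N}^{-1}}$ on $\boldsymbol{X}$. "Independent of discretization or physical parameters" means independent of $\lambda,\mu,K,\alpha,h,\tau$; the constants may depend on $d,\gamma_B^0,\xi^0,\delta$. *)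

theory Defs
  imports "HOL-Analysis.Analysis"
begin

section \<open>Lebesgue and Sobolev spaces on a domain\<close>

text \<open>
  Functions on a domain are represented by functions on the whole space; only their values
  on the domain matter for the definitions of this section.
\<close>

definition L2_inner :: "(real^'d) set \<Rightarrow> (real^'d \<Rightarrow> 'b::real_inner) \<Rightarrow> (real^'d \<Rightarrow> 'b) \<Rightarrow> real" where
  "L2_inner \<Omega> f g = (\<integral>x. f x \<bullet> g x \<partial>lebesgue_on \<Omega>)"

definition L2_norm :: "(real^'d) set \<Rightarrow> (real^'d \<Rightarrow> 'b::real_inner) \<Rightarrow> real" where
  "L2_norm \<Omega> f = sqrt (L2_inner \<Omega> f f)"

definition L2_space :: "(real^'d) set \<Rightarrow> (real^'d \<Rightarrow> real) set" where
  "L2_space \<Omega> = {f \<in> borel_measurable (lebesgue_on \<Omega>). integrable (lebesgue_on \<Omega>) (\<lambda>x. (f x)\<^sup>2)}"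

definition partial :: "'d \<Rightarrow> (real^'d \<Rightarrow> real) \<Rightarrow> real^'d \<Rightarrow> real" where
  "partial i f x = frechet_derivative f (at x) (axis i 1)"

primrec Ck :: "nat \<Rightarrow> (real^'d \<Rightarrow> real) \<Rightarrow> bool" where
  "Ck 0 f \<longleftrightarrow> continuous_on UNIV f"
| "Ck (Suc n) f \<longleftrightarrow> (\<forall>x. f differentiable (at x)) \<and> (\<forall>i. Ck n (partial i f))"

definition test_functions :: "(real^'d) set \<Rightarrow> (real^'d \<Rightarrow> real) set" where
  "test_functions \<Omega> = {\<phi>. (\<forall>n. Ck n \<phi>) \<and> compact (closure {x. \<phi> x \<noteq> 0})
      \<and> closure {x. \<phi> x \<noteq> 0} \<subseteq> \<Omega>}"

definition has_weak_partial ::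
  "(real^'d) set \<Rightarrow> 'd \<Rightarrow> (real^'d \<Rightarrow> real) \<Rightarrow> (real^'d \<Rightarrow> real) \<Rightarrow> bool" where
  "has_weak_partial \<Omega> i u g \<longleftrightarrow> g \<in> L2_space \<Omega> \<and>
     (\<forall>\<phi>\<in>test_functions \<Omega>. L2_inner \<Omega> u (partial i \<phi>) = - L2_inner \<Omega> g \<phi>)"

text \<open>The weak derivative is determined up to a null set; a representative is chosen.\<close>

definition weak_partial :: "(real^'d) set \<Rightarrow> 'd \<Rightarrow> (real^'d \<Rightarrow> real) \<Rightarrow> real^'d \<Rightarrow> real" where
  "weak_partial \<Omega> i u = (SOME g. has_weak_partial \<Omega> i u g)"

definition grad :: "(real^'d) set \<Rightarrow> (real^'d \<Rightarrow> real) \<Rightarrow> real^'d \<Rightarrow> real^'d" where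
  "grad \<Omega> u x = (\<chi> i. weak_partial \<Omega> i u x)"

definition H1_space :: "(real^'d) set \<Rightarrow> (real^'d \<Rightarrow> real) set" where
  "H1_space \<Omega> = {u \<in> L2_space \<Omega>. \<forall>i. \<exists>g. has_weak_partial \<Omega> i u g}"

definition H1_norm :: "(real^'d) set \<Rightarrow> (real^'d \<Rightarrow> real) \<Rightarrow> real" where
  "H1_norm \<Omega> u = sqrt ((L2_norm \<Omega> u)\<^sup>2 + (L2_norm \<Omega> (grad \<Omega> u))\<^sup>2)"

definition H10_space :: "(real^'d) set \<Rightarrow> (real^'d \<Rightarrow> real) set" where
  "H10_space \<Omega> = {u \<in> H1_space \<Omega>. \<exists>\<phi>::nat \<Rightarrow> real^'d \<Rightarrow> real.
      (\<forall>n. \<phi> n \<in> test_functions \<Omega>) \<and> (\<lambda>n. H1_norm \<Omega> (\<lambda>x. u x - \<phi> n x)) \<longlonglongrightarrow> 0}"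

text \<open>
  Vector fields. Row \<open>i\<close> of the Jacobian is the gradient of the \<open>i\<close>-th component, and the
  inner product of \<open>real^'d^'d\<close> is the Frobenius product.
\<close>

definition jacobian :: "(real^'d) set \<Rightarrow> (real^'d \<Rightarrow> real^'d) \<Rightarrow> real^'d \<Rightarrow> real^'d^'d" where
  "jacobian \<Omega> u x = (\<chi> i. grad \<Omega> (\<lambda>y. u y $ i) x)"

definition strain :: "(real^'d) set \<Rightarrow> (real^'d \<Rightarrow> real^'d) \<Rightarrow> real^'d \<Rightarrow> real^'d^'d" where
  "strain \<Omega> u x = (1/2) *\<^sub>R (jacobian \<Omega> u x + transpose (jacobian \<Omega> u x))"

definition divergence :: "(real^'d) set \<Rightarrow> (real^'d \<Rightarrow> real^'d) \<Rightarrow> real^'d \<Rightarrow> real" where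
  "divergence \<Omega> u x = trace (jacobian \<Omega> u x)"

definition H1_norm_vec :: "(real^'d) set \<Rightarrow> (real^'d \<Rightarrow> real^'d) \<Rightarrow> real" where
  "H1_norm_vec \<Omega> u = sqrt ((L2_norm \<Omega> u)\<^sup>2 + (L2_norm \<Omega> (jacobian \<Omega> u))\<^sup>2)"

text \<open>
  Regularity of the boundary is understood in the Lipschitz sense: near each boundary point,
  in a direction \<open>e\<close>, the domain is the strict subgraph of a Lipschitz function on the
  hyperplane orthogonal to \<open>e\<close>.
\<close>

definition lipschitz_boundary :: "(real^'d) set \<Rightarrow> bool" where
  "lipschitz_boundary \<Omega> \<longleftrightarrow> (\<forall>z\<in>frontier \<Omega>. \<exists>r>0. \<exists>e L. \<exists>g :: real^'d \<Rightarrow> real.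
      norm e = 1 \<and> L-lipschitz_on {y. y \<bullet> e = 0} g \<and>
      \<Omega> \<inter> ball z r = {x \<in> ball z r. x \<bullet> e < g (x - (x \<bullet> e) *\<^sub>R e)})"


section \<open>Finite-element spaces\<close>

text \<open>
  The meshed region is contained in the closure of the domain; equality is the case of a
  polygonal or polyhedral domain, while a proper inclusion allows a domain with curved
  boundary, on which the finite-element functions are extended by zero.
\<close>

definition mesh :: "(real^'d) set \<Rightarrow> (real^'d) set set \<Rightarrow> real \<Rightarrow> bool" where
  "mesh \<Omega> \<T> h \<longleftrightarrow> \<T> \<noteq> {} \<and> triangulation \<T> \<and> (\<forall>T\<in>\<T>. int CARD('d) simplex T)
     \<and> \<Union>\<T> \<subseteq> closure \<Omega> \<and> h = Max (diameter ` \<T>)"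

definition affine_fun :: "(real^'d \<Rightarrow> real) \<Rightarrow> bool" where
  "affine_fun p \<longleftrightarrow> (\<exists>a b. \<forall>x. p x = a \<bullet> x + b)"

definition vertices :: "(real^'d) set \<Rightarrow> (real^'d) set" where
  "vertices T = {z. z extreme_point_of T}"

definition barycentric :: "(real^'d) set \<Rightarrow> real^'d \<Rightarrow> real^'d \<Rightarrow> real" where
  "barycentric T z = (THE l. affine_fun l \<and> (\<forall>w\<in>vertices T. l w = (if w = z then 1 else 0)))"

definition bubble :: "(real^'d) set \<Rightarrow> real^'d \<Rightarrow> real" where
  "bubble T x = (\<Prod>z\<in>vertices T. barycentric T z x)"

definition local_P1 :: "(real^'d) set \<Rightarrow> (real^'d \<Rightarrow> real) set" where
  "local_P1 T = {p. affine_fun p}"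

definition local_P1_bubble :: "(real^'d) set \<Rightarrow> (real^'d \<Rightarrow> real) set" where
  "local_P1_bubble T = {\<lambda>x. p x + c * bubble T x | p c. affine_fun p}"

text \<open>
  Continuous representatives, extended by zero outside the domain, are used, so that
  a finite-element function is the zero element exactly if it vanishes everywhere.
\<close>

definition fe_space ::
  "(real^'d) set \<Rightarrow> (real^'d) set set \<Rightarrow> ((real^'d) set \<Rightarrow> (real^'d \<Rightarrow> real) set) \<Rightarrow> (real^'d \<Rightarrow> real) set" where
  "fe_space \<Omega> \<T> P = {v \<in> H10_space \<Omega>. continuous_on UNIV v
      \<and> (\<forall>x. x \<notin> \<Omega> \<inter> \<Union>\<T> \<longrightarrow> v x = 0)
      \<and> (\<forall>T\<in>\<T>. \<exists>p\<in>P T. \<forall>x\<in>T. v x = p x)}"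

datatype fe_pair = P1P1 | Mini

fun displacement_space :: "fe_pair \<Rightarrow> (real^'d) set \<Rightarrow> (real^'d) set set \<Rightarrow> (real^'d \<Rightarrow> real^'d) set" where
  "displacement_space P1P1 \<Omega> \<T> = {v. \<forall>i. (\<lambda>x. v x $ i) \<in> fe_space \<Omega> \<T> local_P1}"
| "displacement_space Mini \<Omega> \<T> = {v. \<forall>i. (\<lambda>x. v x $ i) \<in> fe_space \<Omega> \<T> local_P1_bubble}"

definition pressure_space :: "(real^'d) set \<Rightarrow> (real^'d) set set \<Rightarrow> (real^'d \<Rightarrow> real) set" where
  "pressure_space \<Omega> \<T> = fe_space \<Omega> \<T> local_P1"

text \<open>The supremum is taken in the extended reals, hence needs no boundedness proviso.\<close>

definition weak_inf_sup ::
  "(real^'d) set \<Rightarrow> (real^'d \<Rightarrow> real^'d) set \<Rightarrow> (real^'d \<Rightarrow> real) set \<Rightarrow> real \<Rightarrow> real \<Rightarrow> real \<Rightarrow> bool" where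
  "weak_inf_sup \<Omega> V Q h \<gamma> \<xi> \<longleftrightarrow> (\<forall>q\<in>Q.
     (SUP v\<in>V - {\<lambda>x. 0}. ereal (L2_inner \<Omega> (divergence \<Omega> v) q / H1_norm_vec \<Omega> v))
       \<ge> ereal (\<gamma> * L2_norm \<Omega> q - \<xi> * h * L2_norm \<Omega> (grad \<Omega> q)))"


section \<open>Discrete operators\<close>

definition a_form :: "(real^'d) set \<Rightarrow> real \<Rightarrow> real \<Rightarrow> (real^'d \<Rightarrow> real^'d) \<Rightarrow> (real^'d \<Rightarrow> real^'d) \<Rightarrow> real" where
  "a_form \<Omega> lam \<mu> u v = 2 * \<mu> * L2_inner \<Omega> (strain \<Omega> u) (strain \<Omega> v)
     + lam * L2_inner \<Omega> (divergence \<Omega> u) (divergence \<Omega> v)"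

definition ap_form :: "(real^'d) set \<Rightarrow> real \<Rightarrow> (real^'d \<Rightarrow> real) \<Rightarrow> (real^'d \<Rightarrow> real) \<Rightarrow> real" where
  "ap_form \<Omega> K p q = L2_inner \<Omega> (\<lambda>x. K *\<^sub>R grad \<Omega> p x) (grad \<Omega> q)"

text \<open>
  The dual of a space \<open>W\<close> of functions consists of the linear functionals on \<open>W\<close>, made unique
  as HOL functions by being \<open>undefined\<close> outside \<open>W\<close> (\<open>restrict\<close> produces such functions).
\<close>

definition dual_space :: "('a \<Rightarrow> 'b::real_vector) set \<Rightarrow> (('a \<Rightarrow> 'b) \<Rightarrow> real) set" where
  "dual_space W = {f \<in> extensional W. \<forall>u\<in>W. \<forall>v\<in>W. \<forall>a b.
      f (\<lambda>x. a *\<^sub>R u x + b *\<^sub>R v x) = a * f u + b * f v}"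

text \<open>Elements of the product space and of its dual, with dimension \<open>'d\<close>.\<close>

type_synonym 'd pair = "(real^'d \<Rightarrow> real^'d) \<times> (real^'d \<Rightarrow> real)"
type_synonym 'd dual_pair = "((real^'d \<Rightarrow> real^'d) \<Rightarrow> real) \<times> ((real^'d \<Rightarrow> real) \<Rightarrow> real)"

definition dual_prod :: "(real^'d \<Rightarrow> real^'d) set \<Rightarrow> (real^'d \<Rightarrow> real) set \<Rightarrow> 'd dual_pair set" where
  "dual_prod V Q = dual_space V \<times> dual_space Q"

fun duality :: "'d::finite dual_pair \<Rightarrow> 'd pair \<Rightarrow> real" where
  "duality (f, g) (v, q) = f v + g q"

definition op_Au where
  "op_Au \<Omega> V lam \<mu> u = (\<lambda>v\<in>V. a_form \<Omega> lam \<mu> u v)"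

definition op_B where
  "op_B \<Omega> Q u = (\<lambda>q\<in>Q. - L2_inner \<Omega> (divergence \<Omega> u) q)"

definition op_BT where
  "op_BT \<Omega> V Q p = (\<lambda>v\<in>V. op_B \<Omega> Q v p)"

definition op_Ap where
  "op_Ap \<Omega> Q K p = (\<lambda>q\<in>Q. ap_form \<Omega> K p q)"

definition op_Lp where
  "op_Lp \<Omega> Q p = (\<lambda>q\<in>Q. L2_inner \<Omega> (grad \<Omega> p) (grad \<Omega> q))"

definition op_M :: "(real^'d) set \<Rightarrow> (real^'d \<Rightarrow> real) set \<Rightarrow> (real^'d \<Rightarrow> real) \<Rightarrow> (real^'d \<Rightarrow> real) \<Rightarrow> real" where
  "op_M \<Omega> Q p = (\<lambda>q\<in>Q. L2_inner \<Omega> p q)"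

text \<open>
  The three block operators from \<open>V \<times> Q\<close> to its dual; \<open>s\<close> stands for
  \<open>\<alpha>\<^sup>2 / \<zeta>\<^sup>2\<close>, the weight of the mass operator.
\<close>

fun biot_op :: "(real^'d) set \<Rightarrow> (real^'d \<Rightarrow> real^'d) set \<Rightarrow> (real^'d \<Rightarrow> real) set \<Rightarrow>
    real \<Rightarrow> real \<Rightarrow> real \<Rightarrow> real \<Rightarrow> real \<Rightarrow> real \<Rightarrow> real \<Rightarrow> 'd pair \<Rightarrow> 'd dual_pair" where
  "biot_op \<Omega> V Q lam \<mu> \<alpha> K h \<tau> \<eta> (u, p) =
     ((\<lambda>v\<in>V. op_Au \<Omega> V lam \<mu> u v + \<alpha> * op_BT \<Omega> V Q p v),
      (\<lambda>q\<in>Q. - \<alpha> * op_B \<Omega> Q u q + \<tau> * op_Ap \<Omega> Q K p q + \<eta> * h\<^sup>2 * op_Lp \<Omega> Q p q))"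

fun lower_op :: "(real^'d) set \<Rightarrow> (real^'d \<Rightarrow> real^'d) set \<Rightarrow> (real^'d \<Rightarrow> real) set \<Rightarrow>
    real \<Rightarrow> real \<Rightarrow> real \<Rightarrow> real \<Rightarrow> real \<Rightarrow> real \<Rightarrow> real \<Rightarrow> real \<Rightarrow> 'd pair \<Rightarrow> 'd dual_pair" where
  "lower_op \<Omega> V Q lam \<mu> \<alpha> K h \<tau> \<eta> s (u, p) =
     (op_Au \<Omega> V lam \<mu> u,
      (\<lambda>q\<in>Q. - \<alpha> * op_B \<Omega> Q u q + \<tau> * op_Ap \<Omega> Q K p q + \<eta> * h\<^sup>2 * op_Lp \<Omega> Q p q
              + s * op_M \<Omega> Q p q))"

fun diag_op :: "(real^'d) set \<Rightarrow> (real^'d \<Rightarrow> real^'d) set \<Rightarrow> (real^'d \<Rightarrow> real) set \<Rightarrow>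
    real \<Rightarrow> real \<Rightarrow> real \<Rightarrow> real \<Rightarrow> real \<Rightarrow> real \<Rightarrow> real \<Rightarrow> 'd pair \<Rightarrow> 'd dual_pair" where
  "diag_op \<Omega> V Q lam \<mu> K h \<tau> \<eta> s (u, p) =
     (op_Au \<Omega> V lam \<mu> u,
      (\<lambda>q\<in>Q. \<tau> * op_Ap \<Omega> Q K p q + \<eta> * h\<^sup>2 * op_Lp \<Omega> Q p q + s * op_M \<Omega> Q p q))"

text \<open>
  The inner product and norm on \<open>V \<times> Q\<close> induced by the inverse of an operator \<open>N\<close> from the
  dual to \<open>V \<times> Q\<close>.
\<close>

definition inner_inv ::
  "(real^'d \<Rightarrow> real^'d) set \<Rightarrow> (real^'d \<Rightarrow> real) set \<Rightarrow> ('d dual_pair \<Rightarrow> 'd pair) \<Rightarrow> 'd pair \<Rightarrow> 'd pair \<Rightarrow> real" where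
  "inner_inv V Q N x y = duality (inv_into (dual_prod V Q) N x) y"

definition norm_inv ::
  "(real^'d \<Rightarrow> real^'d) set \<Rightarrow> (real^'d \<Rightarrow> real) set \<Rightarrow> ('d dual_pair \<Rightarrow> 'd pair) \<Rightarrow> 'd pair \<Rightarrow> real" where
  "norm_inv V Q N x = sqrt (inner_inv V Q N x x)"

end

theory Submission
  imports Defs
begin

text \<open>
  Let \<open>(w, r) = BL (A (u, p))\<close>, let \<open>c\<^sub>1\<close> be the form of \<open>\<tau> A\<^sub>p + \<eta> h\<^sup>2 L\<^sub>p\<close>, let \<open>m\<close> be the
  \<open>L\<^sup>2\<close> product and \<open>s = \<alpha>\<^sup>2 / \<zeta>\<^sup>2\<close>. The error \<open>e = w - u\<close> satisfies
  \<open>a e v = - \<alpha> (div v, p)\<close> for all \<open>v\<close>, and testing the second equation with \<open>p\<close> shows that the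
  numerator of the first quotient is \<open>a u u + a e u + a e e + c\<^sub>1 p p\<close>, which dominates half of
  \<open>a u u + a e e + 2 c\<^sub>1 p p\<close>. The weak inf-sup condition, together with
  \<open>a v v \<le> d \<zeta>\<^sup>2 \<parallel>v\<parallel>\<^sub>1\<^sup>2\<close>, bounds \<open>s m p p\<close> by multiples of \<open>a e e\<close> and of the stabilization
  part of \<open>c\<^sub>1 p p\<close>. The upper bound follows from \<open>\<zeta>\<^sup>2 \<parallel>div v\<parallel>\<^sup>2 \<le> a v v\<close>.

  For the operators to be invertible, \<open>a\<close> has to be definite. Korn's inequality is not needed:
  if the strain vanishes then \<open>\<partial>\<^sub>i v\<^sub>i = 0\<close>, hence \<open>v\<^sub>i = 0\<close> by Poincare's inequality in the
  direction \<open>i\<close>.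
\<close>

section \<open>Symmetric forms on spaces of functions\<close>

text \<open>The constants must not see the domain, and this decides where analysis may enter.
  Poincare's inequality, whose constant depends on the domain, serves only for definiteness; the
  quantitative part rests on pointwise matrix inequalities, Cauchy-Schwarz and the weak inf-sup
  condition. The error \<open>e\<close> is the Riesz representative of the coupling functional in
  the product \<open>a\<close>, so \<open>a e e\<close> is a squared dual norm of that functional.
  Hence inf-sup bounds it from below and continuity from above, and the weight \<open>s\<close> is
  what makes the physical parameters cancel in both bounds.

  Two encodings cause most of the remaining work. Weak derivatives are chosen representatives, so
  differentiation is linear only almost everywhere; this calls for uniqueness of weak derivatives
  and therefore for sufficiently many test functions. Moreover, \<open>inner_inv\<close> applies an
  inverse to an inverse, so it becomes the form \<open>a + c0\<close> only once the diagonal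
  operator is known to be a bijection onto the dual.\<close>

definition lin_space :: "('a \<Rightarrow> 'b::real_vector) set \<Rightarrow> bool" where
  "lin_space W \<longleftrightarrow> W \<noteq> {} \<and> (\<forall>u\<in>W. \<forall>v\<in>W. \<forall>a b. (\<lambda>x. a *\<^sub>R u x + b *\<^sub>R v x) \<in> W)"

text \<open>Linearity is confined to \<open>W\<close>: outside the Sobolev space a weak derivative
  is an arbitrary function, so the forms below need not be linear there.\<close>

definition lin_on :: "('a \<Rightarrow> 'b::real_vector) set \<Rightarrow> (('a \<Rightarrow> 'b) \<Rightarrow> real) \<Rightarrow> bool" where
  "lin_on W f \<longleftrightarrow> (\<forall>u\<in>W. \<forall>v\<in>W. \<forall>a b.
     f (\<lambda>x. a *\<^sub>R u x + b *\<^sub>R v x) = a * f u + b * f v)"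

lemma lin_spaceD:
  "lin_space W \<Longrightarrow> u \<in> W \<Longrightarrow> v \<in> W \<Longrightarrow> (\<lambda>x. a *\<^sub>R u x + b *\<^sub>R v x) \<in> W"
  by (auto simp: lin_space_def)

lemma lin_onD:
  "lin_on W f \<Longrightarrow> u \<in> W \<Longrightarrow> v \<in> W \<Longrightarrow> f (\<lambda>x. a *\<^sub>R u x + b *\<^sub>R v x) = a * f u + b * f v"
  by (auto simp: lin_on_def)

lemma lin_space_zero:
  assumes "lin_space W"
  shows "(\<lambda>_. 0) \<in> W"
proof -
  from assms obtain u where u: "u \<in> W"
    by (auto simp: lin_space_def)
  show ?thesis
    using lin_spaceD[OF assms u u, of 0 0] by simp
qed

lemma lin_on_zero:
  assumes "lin_space W" "lin_on W f"
  shows "f (\<lambda>_. 0) = 0"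
  using lin_onD[OF assms(2) lin_space_zero[OF assms(1)] lin_space_zero[OF assms(1)], of 0 0] by simp

lemma lin_space_diff:
  "lin_space W \<Longrightarrow> u \<in> W \<Longrightarrow> v \<in> W \<Longrightarrow> (\<lambda>x. u x - v x) \<in> W"
  using lin_spaceD[of W u v 1 "-1"] by simp

lemma lin_on_diff:
  "lin_on W f \<Longrightarrow> u \<in> W \<Longrightarrow> v \<in> W \<Longrightarrow> f (\<lambda>x. u x - v x) = f u - f v"
  using lin_onD[of W f u v 1 "-1"] by simp

lemma lin_on_combine:
  assumes "lin_on W f" "lin_on W g"
  shows "lin_on W (\<lambda>u. a * f u + b * g u)"
  using assms by (auto simp: lin_on_def algebra_simps)

text \<open>Definiteness is left out so that the gradient, strain and divergence forms are instances
  as well; where an equation has to be solved, it is assumed separately.\<close>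

locale semi_inner =
  fixes W :: "('a \<Rightarrow> 'b::real_vector) set" and c :: "('a \<Rightarrow> 'b) \<Rightarrow> ('a \<Rightarrow> 'b) \<Rightarrow> real"
  assumes space: "lin_space W"
    and sym: "u \<in> W \<Longrightarrow> v \<in> W \<Longrightarrow> c u v = c v u"
    and lin: "v \<in> W \<Longrightarrow> lin_on W (\<lambda>u. c u v)"
    and nonneg: "u \<in> W \<Longrightarrow> 0 \<le> c u u"
begin

lemma lin': "u \<in> W \<Longrightarrow> lin_on W (c u)"
  using lin[of u] space sym unfolding lin_on_def
  by (smt (verit) lin_spaceD)

lemma combine_self:
  assumes "u \<in> W" "v \<in> W"
  shows "c (\<lambda>x. a *\<^sub>R u x + b *\<^sub>R v x) (\<lambda>x. a *\<^sub>R u x + b *\<^sub>R v x)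
    = a\<^sup>2 * c u u + 2 * a * b * c u v + b\<^sup>2 * c v v"
proof -
  have w: "(\<lambda>x. a *\<^sub>R u x + b *\<^sub>R v x) \<in> W"
    using assms space by (rule_tac lin_spaceD)
  show ?thesis
    using lin_onD[OF lin[OF w] assms, of a b] lin_onD[OF lin'[OF assms(1)] assms, of a b]
      lin_onD[OF lin'[OF assms(2)] assms, of a b] sym[OF assms]
    by (simp add: power2_eq_square algebra_simps)
qed

lemma cauchy_schwarz:
  assumes "u \<in> W" "v \<in> W"
  shows "(c u v)\<^sup>2 \<le> c u u * c v v"
proof -
  have ge: "0 \<le> a\<^sup>2 * c u u + 2 * a * b * c u v + b\<^sup>2 * c v v" for a b
    using nonneg[OF lin_spaceD[OF space assms, of a b]] combine_self[OF assms, of a b] by simp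
  show ?thesis
  proof (cases "c v v = 0")
    case True
    have "c u v = 0"
    proof (rule ccontr)
      assume "c u v \<noteq> 0"
      \<comment> \<open>With \<open>c v v = 0\<close> the quadratic is affine in \<open>b\<close>,
        and this \<open>b\<close> makes its value -1.\<close>
      then show False
        using ge[of 1 "- (c u u + 1) / (2 * c u v)"] True by (simp add: field_simps)
    qed
    then show ?thesis using True by simp
  next
    case False
    then have "c v v > 0" using nonneg[OF assms(2)] by simp
    then show ?thesis
      using ge[of 1 "- c u v / c v v"]
      by (simp add: field_simps power2_eq_square)
  qed
qed

text \<open>Parallelogram law: the combination with \<open>- b\<close> has a nonnegative square, and
  adding it removes the mixed term.\<close>

lemma combine_self_le:
  assumes "u \<in> W" "v \<in> W"
  shows "c (\<lambda>x. a *\<^sub>R u x + b *\<^sub>R v x) (\<lambda>x. a *\<^sub>R u x + b *\<^sub>R v x)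
    \<le> 2 * a\<^sup>2 * c u u + 2 * b\<^sup>2 * c v v"
  using combine_self[OF assms, of a b] combine_self[OF assms, of a "- b"]
    nonneg[OF lin_spaceD[OF space assms, of a "- b"]] by (simp add: algebra_simps)

lemma semi_inner_subspace: "lin_space W' \<Longrightarrow> W' \<subseteq> W \<Longrightarrow> semi_inner W' c"
  using sym lin nonneg by unfold_locales (auto simp: lin_on_def subset_iff)

end

lemma semi_inner_cong:
  assumes "semi_inner W c" "\<And>u v. u \<in> W \<Longrightarrow> v \<in> W \<Longrightarrow> c u v = c' u v"
  shows "semi_inner W c'"
proof -
  interpret c: semi_inner W c by fact
  show ?thesis
  proof
    show "lin_on W (\<lambda>u. c' u v)" if v: "v \<in> W" for v
      using c.lin[OF v] assms(2)[OF _ v] lin_spaceD[OF c.space] by (simp add: lin_on_def)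
    show "c' u v = c' v u" if "u \<in> W" "v \<in> W" for u v
      using c.sym[OF that] assms(2)[of u v] assms(2)[of v u] that by simp
    show "0 \<le> c' u u" if "u \<in> W" for u
      using c.nonneg[OF that] assms(2)[of u u] that by simp
  qed (rule c.space)
qed

lemma semi_inner_combine:
  assumes "semi_inner W c" "semi_inner W c'" "0 \<le> a" "0 \<le> b"
  shows "semi_inner W (\<lambda>u v. a * c u v + b * c' u v)"
proof -
  interpret c: semi_inner W c by fact
  interpret c': semi_inner W c' by fact
  show ?thesis
    using assms(3,4) c.space c.sym c'.sym c.nonneg c'.nonneg c.lin c'.lin
    by unfold_locales (auto intro: lin_on_combine)
qed

lemma semi_inner_sum:
  assumes "finite I" "\<And>i. i \<in> I \<Longrightarrow> semi_inner W (c i)" "lin_space W"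
  shows "semi_inner W (\<lambda>u v. \<Sum>i\<in>I. c i u v)"
  using assms(1,2)
proof (induction I rule: finite_induct)
  case empty
  show ?case using assms(3) by unfold_locales (auto simp: lin_on_def)
next
  case (insert i I)
  then show ?case
    using semi_inner_combine[of W "c i" "\<lambda>u v. \<Sum>i\<in>I. c i u v" 1 1] by simp
qed

text \<open>
  Instead of a basis, finite dimension is expressed by a finite separating family of functionals,
  which is what a finite-element space offers most directly.
\<close>

lemma riesz_representation:
  assumes "finite L"
    and "semi_inner W c" and "\<And>u. u \<in> W \<Longrightarrow> c u u = 0 \<Longrightarrow> u = (\<lambda>_. 0)"
    and "\<And>l. l \<in> L \<Longrightarrow> lin_on W l"
    and "\<And>u. u \<in> W \<Longrightarrow> (\<And>l. l \<in> L \<Longrightarrow> l u = 0) \<Longrightarrow> u = (\<lambda>_. 0)"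
    and "lin_on W f"
  shows "\<exists>u\<in>W. \<forall>v\<in>W. c u v = f v"
  using assms
proof (induction L arbitrary: W f rule: finite_induct)
  case (empty W f)
  interpret semi_inner W c by fact
  have "v = (\<lambda>_. 0)" if "v \<in> W" for v using empty.prems(4)[OF that] by simp
  then show ?case
    using lin_space_zero[OF space] lin_on_zero[OF space \<open>lin_on W f\<close>] lin_on_zero[OF space lin']
    by metis
next
  case (insert l L W f)
  interpret semi_inner W c by fact
  have l: "lin_on W l" and f: "lin_on W f" using insert.prems by auto
  \<comment> \<open>On the kernel of \<open>l\<close> the functionals in \<open>L\<close> alone
    separate, so the induction hypothesis solves the problem there. At most one further direction
    remains.\<close>
  define W0 where "W0 = {w \<in> W. l w = 0}"
  have sub: "W0 \<subseteq> W" by (auto simp: W0_def)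
  have sp0: "lin_space W0"
    using space lin_space_zero[OF space] lin_on_zero[OF space l] l
    unfolding lin_space_def W0_def lin_on_def by auto
  have restr: "lin_on W0 g" if "lin_on W g" for g
    using that sub unfolding lin_on_def by blast
  have riesz0: "\<exists>u\<in>W0. \<forall>v\<in>W0. c u v = g v" if g: "lin_on W g" for g
  proof (rule insert.IH)
    show "semi_inner W0 c" using semi_inner_subspace[OF sp0 sub] .
    show "u = (\<lambda>_. 0)" if "u \<in> W0" "\<And>l. l \<in> L \<Longrightarrow> l u = 0" for u
      using insert.prems(4)[of u] that by (auto simp: W0_def)
  qed (use insert.prems sub restr g in auto)
  obtain u0 where u0: "u0 \<in> W0" "\<And>v. v \<in> W0 \<Longrightarrow> c u0 v = f v"
    using riesz0[OF f] by blast
  show ?case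
  proof (cases "W0 = W")
    case True
    then show ?thesis using u0 by blast
  next
    case False
    then obtain w where w: "w \<in> W" "l w \<noteq> 0" by (auto simp: W0_def)
    \<comment> \<open>\<open>w'\<close> is the projection of \<open>w\<close> to \<open>W0\<close>,
      obtained by representing \<open>c w\<close> on \<open>W0\<close>. Thus \<open>w1\<close> is
      orthogonal to \<open>W0\<close> and still has \<open>l w1\<close> nonzero.\<close>
    obtain w' where w': "w' \<in> W0" "\<And>v. v \<in> W0 \<Longrightarrow> c w' v = c w v"
      using riesz0[OF lin'[OF w(1)]] by blast
    define w1 where "w1 = (\<lambda>x. w x - w' x)"
    have w'W: "w' \<in> W" "l w' = 0" using w' by (auto simp: W0_def)
    have w1W: "w1 \<in> W" unfolding w1_def using lin_space_diff[OF space w(1) w'W(1)] .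
    have lw1: "l w1 \<noteq> 0" unfolding w1_def using lin_on_diff[OF l w(1) w'W(1)] w w'W by simp
    have orth: "c w1 v = 0" if "v \<in> W0" for v
      unfolding w1_def using lin_on_diff[OF lin, of v w w'] w(1) w'W that w'(2)[OF that] sub by auto
    have "w1 \<noteq> (\<lambda>_. 0)" using lw1 lin_on_zero[OF space l] by metis
    then have cw1: "c w1 w1 \<noteq> 0" using insert.prems(2)[OF w1W] by auto
    \<comment> \<open>By orthogonality the second summand does not change the values on
      \<open>W0\<close>, and its coefficient is forced by testing with \<open>w1\<close>.\<close>
    define u where "u = (\<lambda>x. 1 *\<^sub>R u0 x + (f w1 / c w1 w1) *\<^sub>R w1 x)"
    have u0W: "u0 \<in> W" using u0 sub by auto
    have uW: "u \<in> W" unfolding u_def by (rule lin_spaceD[OF space u0W w1W])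
    have "c u v = f v" if v: "v \<in> W" for v
    proof -
      \<comment> \<open>This \<open>t\<close> puts \<open>v - t w1\<close> into the kernel of
        \<open>l\<close>, so only the tests with \<open>v0\<close> and with \<open>w1\<close>
        remain.\<close>
      define t where "t = l v / l w1"
      define v0 where "v0 = (\<lambda>x. 1 *\<^sub>R v x + (- t) *\<^sub>R w1 x)"
      have "l v0 = 0"
        unfolding v0_def using lin_onD[OF l v w1W, of 1 "-t"] lw1 by (simp add: t_def)
      then have v0: "v0 \<in> W0" "v0 \<in> W"
        using lin_spaceD[OF space v w1W, of 1 "-t"] by (auto simp: W0_def v0_def)
      have fv: "f v = f v0 + t * f w1"
        unfolding v0_def using lin_onD[OF f v w1W, of 1 "-t"] by simp
      have cv: "c u v = c u v0 + t * c u w1"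
        unfolding v0_def using lin_onD[OF lin'[OF uW] v w1W, of 1 "-t"] by simp
      have "c u v0 = f v0"
        unfolding u_def using lin_onD[OF lin[OF v0(2)] u0W w1W, of 1 "f w1 / c w1 w1"]
          u0(2)[OF v0(1)] orth[OF v0(1)] by simp
      moreover have "c u w1 = f w1"
        unfolding u_def using lin_onD[OF lin[OF w1W] u0W w1W, of 1 "f w1 / c w1 w1"]
          orth[OF u0(1)] sym[OF u0W w1W] cw1 by simp
      ultimately show ?thesis using fv cv by simp
    qed
    then show ?thesis using uW by blast
  qed
qed

section \<open>The estimate for abstract forms\<close>

text \<open>
  With \<open>e = w - u\<close> the equations read \<open>a e v = - \<alpha> b v p\<close> and
  \<open>c\<^sub>0 r q = c\<^sub>1 p q - \<alpha> b e q\<close>, where \<open>c\<^sub>0 = c\<^sub>1 + s m\<close>.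
\<close>

lemma block_triangular_estimate:
  assumes "semi_inner V a" and "semi_inner Q c1" and "semi_inner Q m" and "s > 0"
    and b: "\<And>q. q \<in> Q \<Longrightarrow> lin_on V (\<lambda>v. b v q)"
    and cont: "\<And>v q. v \<in> V \<Longrightarrow> q \<in> Q \<Longrightarrow> (\<alpha> * b v q)\<^sup>2 \<le> a v v * (s * m q q)"
    and inf_sup: "\<And>e p. e \<in> V \<Longrightarrow> p \<in> Q \<Longrightarrow> (\<And>v. v \<in> V \<Longrightarrow> a e v = - \<alpha> * b v p) \<Longrightarrow>
       s * m p p \<le> X * c1 p p + Y * a e e"
    and XY: "X \<ge> 0" "Y \<ge> 0"
    and mem: "u \<in> V" "w \<in> V" "p \<in> Q" "r \<in> Q"
    and eq1: "\<And>v. v \<in> V \<Longrightarrow> a w v = a u v - \<alpha> * b v p"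
    and eq2: "\<And>q. q \<in> Q \<Longrightarrow> \<alpha> * b w q + (c1 r q + s * m r q) = \<alpha> * b u q + c1 p q"
  shows "a u u + (c1 p p + s * m p p)
      \<le> (2 + X + 2 * Y) * (a w u + (c1 r p + s * m r p))"
    and "a w w + (c1 r r + s * m r r) \<le> 4 * (a u u + (c1 p p + s * m p p))"
proof -
  interpret a: semi_inner V a by fact
  interpret c1: semi_inner Q c1 by fact
  interpret m: semi_inner Q m by fact
  define c0 where "c0 = (\<lambda>u v. 1 * c1 u v + s * m u v)"
  interpret c0: semi_inner Q c0
    unfolding c0_def
    by (rule semi_inner_combine) (use \<open>s > 0\<close> c1.semi_inner_axioms m.semi_inner_axioms in auto)
  define e where "e = (\<lambda>x. w x - u x)"
  have eV: "e \<in> V" unfolding e_def using lin_space_diff[OF a.space mem(2,1)] .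
  have ae: "a e v = - \<alpha> * b v p" if "v \<in> V" for v
    unfolding e_def using lin_on_diff[OF a.lin[OF that] mem(2,1)] eq1[OF that] by simp
  have be: "b e q = b w q - b u q" if "q \<in> Q" for q
    unfolding e_def using lin_on_diff[OF b[OF that] mem(2,1)] by simp
  have c0r: "c1 r q + s * m r q = c1 p q - \<alpha> * b e q" if "q \<in> Q" for q
    using eq2[OF that] unfolding be[OF that] by (simp add: algebra_simps)
  have nn: "0 \<le> a u u" "0 \<le> a e e" "0 \<le> c1 p p" "0 \<le> m p p" "0 \<le> c1 r r" "0 \<le> m r r"
    using a.nonneg c1.nonneg m.nonneg mem eV by auto
  have weu: "w = (\<lambda>x. e x + u x)" by (auto simp: e_def)
  have awu: "a w u = a e u + a u u"
    unfolding weu using lin_onD[OF a.lin[OF mem(1)] eV mem(1), of 1 1] by simp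
  \<comment> \<open>The error equation with \<open>v = e\<close> turns the coupling term
    \<open>- \<alpha> * b e p\<close> into \<open>a e e\<close>; this is the control over
    \<open>e\<close> that inf-sup later converts into control over \<open>p\<close>.\<close>
  have key: "a w u + (c1 r p + s * m r p) = a u u + a e u + a e e + c1 p p"
    using c0r[OF mem(3)] ae[OF eV] awu by simp
  have "0 \<le> a (\<lambda>x. 1 *\<^sub>R e x + 1 *\<^sub>R u x) (\<lambda>x. 1 *\<^sub>R e x + 1 *\<^sub>R u x)"
    by (rule a.nonneg[OF lin_spaceD[OF a.space eV mem(1)]])
  then have low: "- 2 * a e u \<le> a e e + a u u"
    using a.combine_self[OF eV mem(1), of 1 1] by simp
  define G where "G = a w u + (c1 r p + s * m r p)"
  have G: "2 * G \<ge> a u u + a e e + 2 * c1 p p"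
    unfolding G_def key using low by simp
  have sm: "s * m p p \<le> X * c1 p p + Y * a e e"
    using inf_sup[OF eV mem(3)] ae by blast
  \<comment> \<open>From \<open>G\<close> one reads off \<open>c1 p p \<le> G\<close>,
    \<open>a e e \<le> 2 * G\<close> and \<open>a u u + c1 p p \<le> 2 * G\<close>. They yield the
    summands \<open>X\<close>, \<open>2 * Y\<close> and \<open>2\<close> of the factor.\<close>
  have "X * c1 p p \<le> X * G" "Y * a e e \<le> Y * (2 * G)"
    using XY G nn by (auto intro!: mult_left_mono)
  then show "a u u + (c1 p p + s * m p p)
      \<le> (2 + X + 2 * Y) * (a w u + (c1 r p + s * m r p))"
    using sm G nn unfolding G_def[symmetric] by (simp add: algebra_simps)
  \<comment> \<open>Test the error equation with \<open>e\<close> itself, apply continuity of the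
    coupling, and cancel one factor \<open>a e e\<close> if it is nonzero.\<close>
  have aee: "a e e \<le> s * m p p"
  proof -
    have "(a e e)\<^sup>2 \<le> a e e * (s * m p p)"
      using cont[OF eV mem(3)] ae[OF eV] by simp
    then show ?thesis
      using nn \<open>s > 0\<close> by (cases "a e e = 0") (auto simp: power2_eq_square)
  qed
  \<comment> \<open>The second equation is tested with \<open>r\<close>. Its two terms are bounded
    by separate Cauchy-Schwarz inequalities, and the Cauchy-Schwarz inequality of the plane joins
    them without losing a factor.\<close>
  have c0rr: "c0 r r \<le> c1 p p + a e e"
  proof -
    have 1: "(c1 p r)\<^sup>2 \<le> c1 p p * c1 r r" by (rule c1.cauchy_schwarz[OF mem(3,4)])
    have 2: "(\<alpha> * b e r)\<^sup>2 \<le> a e e * (s * m r r)" by (rule cont[OF eV mem(4)])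
    have "c0 r r = c1 p r - \<alpha> * b e r" using c0r[OF mem(4)] by (simp add: c0_def)
    also have "\<dots> \<le> sqrt (c1 p p) * sqrt (c1 r r) + sqrt (a e e) * sqrt (s * m r r)"
      using real_le_rsqrt[OF 1] real_sqrt_abs[of "\<alpha> * b e r"] real_sqrt_le_mono[OF 2]
      by (simp add: real_sqrt_mult)
    also have "\<dots> \<le> sqrt (c1 p p + a e e) * sqrt (c1 r r + s * m r r)"
    proof (rule power2_le_imp_le)
      have "0 \<le> (sqrt (c1 p p) * sqrt (s * m r r) - sqrt (a e e) * sqrt (c1 r r))\<^sup>2" by simp
      then have "2 * (sqrt (c1 p p) * sqrt (c1 r r) * (sqrt (a e e) * sqrt (s * m r r)))
          \<le> c1 p p * (s * m r r) + a e e * c1 r r"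
        using nn \<open>s > 0\<close> by (simp add: power2_diff power_mult_distrib algebra_simps)
      then show "(sqrt (c1 p p) * sqrt (c1 r r) + sqrt (a e e) * sqrt (s * m r r))\<^sup>2
          \<le> (sqrt (c1 p p + a e e) * sqrt (c1 r r + s * m r r))\<^sup>2"
        using nn \<open>s > 0\<close> by (simp add: power2_sum power_mult_distrib algebra_simps)
    qed (use nn \<open>s > 0\<close> in simp)
    finally have le: "c0 r r \<le> sqrt (c1 p p + a e e) * sqrt (c0 r r)" by (simp add: c0_def)
    have "c0 r r \<ge> 0" by (rule c0.nonneg[OF mem(4)])
    show ?thesis
    proof (cases "c0 r r = 0")
      case True
      then show ?thesis using nn by simp
    next
      case False
      then have "sqrt (c0 r r) > 0" using \<open>c0 r r \<ge> 0\<close> by simp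
      moreover have "sqrt (c0 r r) * sqrt (c0 r r) \<le> sqrt (c1 p p + a e e) * sqrt (c0 r r)"
        using le \<open>c0 r r \<ge> 0\<close> by simp
      ultimately have "sqrt (c0 r r) \<le> sqrt (c1 p p + a e e)"
        using mult_right_le_imp_le by blast
      then show ?thesis by simp
    qed
  qed
  \<comment> \<open>Adding the bounds gives \<open>2 * a u u + 3 * a e e + c1 p p\<close>, where
    \<open>a e e\<close> is at most \<open>s * m p p\<close>. The resulting factor 3 is rounded up
    to 4, whose square root 2 is the final bound.\<close>
  have aww: "a w w \<le> 2 * a e e + 2 * a u u"
    unfolding weu using a.combine_self_le[OF eV mem(1), of 1 1] by simp
  have "0 \<le> s * m p p" using nn \<open>s > 0\<close> by simp
  then show "a w w + (c1 r r + s * m r r) \<le> 4 * (a u u + (c1 p p + s * m p p))"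
    using c0rr aww aee nn by (simp add: c0_def)
qed

section \<open>Smooth functions\<close>

lemma partial_eq: "(f has_derivative f') (at x) \<Longrightarrow> partial i f x = f' (axis i 1)"
  unfolding partial_def by (metis frechet_derivative_at)

lemma has_derivative_partial:
  "f differentiable (at x) \<Longrightarrow> (f has_derivative frechet_derivative f (at x)) (at x)"
  by (simp add: frechet_derivative_works)

lemma partial_combine:
  assumes "f differentiable (at x)" "g differentiable (at x)"
  shows "partial i (\<lambda>x. a * f x + b * g x) x = a * partial i f x + b * partial i g x"
  by (subst partial_eq, rule has_derivative_add; (rule has_derivative_mult_right)?;
      (rule has_derivative_partial)?) (use assms in \<open>auto simp: partial_def\<close>)

lemma partial_mult:
  assumes "f differentiable (at x)" "g differentiable (at x)"
  shows "partial i (\<lambda>x. f x * g x) x = partial i f x * g x + f x * partial i g x"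
  using partial_eq[OF has_derivative_mult[OF has_derivative_partial[OF assms(1)]
        has_derivative_partial[OF assms(2)]], of i]
  by (simp add: partial_def)

lemma Ck_combine: "Ck n f \<Longrightarrow> Ck n g \<Longrightarrow> Ck n (\<lambda>x. a * f x + b * g x)"
proof (induction n arbitrary: f g)
  case 0
  then show ?case by (auto intro!: continuous_intros)
next
  case (Suc n)
  then have "partial i (\<lambda>x. a * f x + b * g x) = (\<lambda>x. a * partial i f x + b * partial i g x)" for i
    by (auto simp: partial_combine)
  moreover have "(\<lambda>x. a * f x + b * g x) differentiable at x" for x
    using Suc by (auto intro!: differentiable_add differentiable_cmult_left_iff[THEN iffD2] derivative_intros)
  ultimately show ?case using Suc by simp
qed

lemma partial_eq_0_outside_closure:
  assumes "x \<notin> closure {x. f x \<noteq> 0}"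
  shows "partial i f x = 0"
proof -
  have "(f has_derivative (\<lambda>h. 0)) (at x)"
    by (rule has_derivative_transform_within_open[where f = "\<lambda>_. 0" and s = "- closure {x. f x \<noteq> 0}"])
       (use assms closure_subset[of "{x. f x \<noteq> 0}"] in auto)
  then show ?thesis by (rule partial_eq)
qed

text \<open>\<open>flat 0\<close> is the usual smooth function that vanishes for negative arguments; the others are
  needed to describe its derivatives.\<close>

definition flat :: "nat \<Rightarrow> real \<Rightarrow> real" where
  "flat m t = (if t \<le> 0 then 0 else exp (- inverse t) * inverse t ^ m)"

text \<open>In the variable \<open>inverse t\<close>, which tends to infinity, this is the decay of
  a power divided by the exponential.\<close>

lemma flat_tendsto_0: "(flat m \<longlongrightarrow> 0) (at_right 0)"
proof -
  have "((\<lambda>t. inverse t ^ m / exp (inverse t)) \<longlongrightarrow> (0::real)) (at_right 0)"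
    by (rule filterlim_compose[OF tendsto_power_div_exp_0 filterlim_inverse_at_top_right])
  then show ?thesis
    by (rule Lim_transform_eventually)
       (auto simp: flat_def eventually_at_right_field exp_minus field_simps intro!: exI[of _ 1])
qed

text \<open>The derivative is again a combination of members of the family, which is why the
  exponent \<open>m\<close> is carried along: smoothness then needs no explicit higher
  derivatives.\<close>

lemma DERIV_flat: "(flat m has_real_derivative flat (m + 2) t - m * flat (m + 1) t) (at t)"
proof -
  consider "t < 0" | "t = 0" | "t > 0" by linarith
  then show ?thesis
  proof cases
    case 1
    have "((\<lambda>_. 0) has_real_derivative 0) (at t)" by simp
    then have "(flat m has_real_derivative 0) (at t)"
      by (rule has_field_derivative_transform_within_open[where S = "{..<0}"])
         (use 1 in \<open>auto simp: flat_def\<close>)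
    then show ?thesis using 1 by (simp add: flat_def)
  next
    case 2
    \<comment> \<open>For positive arguments the difference quotient of \<open>flat m\<close> at 0
      is exactly \<open>flat (m + 1)\<close>.\<close>
    have "((\<lambda>y. (flat m y - flat m 0) / (y - 0)) \<longlongrightarrow> 0) (at_right 0)"
      by (rule Lim_transform_eventually[OF flat_tendsto_0[of "m + 1"]])
         (auto simp: flat_def eventually_at_right_field field_simps intro!: exI[of _ 1])
    moreover have "((\<lambda>y. (flat m y - flat m 0) / (y - 0)) \<longlongrightarrow> 0) (at_left 0)"
      by (rule tendsto_eventually)
         (auto simp: flat_def eventually_at_left_field intro!: exI[of _ "-1"])
    ultimately show ?thesis
      unfolding has_field_derivative_iff using 2 by (simp add: filterlim_at_split flat_def)
  next
    case 3
    have "((\<lambda>t. exp (- inverse t) * inverse t ^ m) has_real_derivative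
        exp (- inverse t) * inverse t ^ (m + 2) - m * (exp (- inverse t) * inverse t ^ (m + 1))) (at t)"
      using 3 by (cases m; auto intro!: derivative_eq_intros simp: field_simps power2_eq_square;
          metis One_nat_def power_eq_if)
    then have "(flat m has_real_derivative
        exp (- inverse t) * inverse t ^ (m + 2) - m * (exp (- inverse t) * inverse t ^ (m + 1))) (at t)"
      by (rule has_field_derivative_transform_within_open[where S = "{0<..}"])
         (use 3 in \<open>auto simp: flat_def\<close>)
    then show ?thesis using 3 by (simp add: flat_def)
  qed
qed

text \<open>An algebra of functions closed under all partial derivatives. Differentiability of its
  members therefore already implies \<open>Ck n\<close> for every \<open>n\<close>, by induction on
  \<open>n\<close>.\<close>

inductive flat_alg :: "(real^'d \<Rightarrow> real) \<Rightarrow> bool" where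
  const: "flat_alg (\<lambda>_. c)"
| flat: "flat_alg (\<lambda>x. flat m (s * x $ i + a))"
| add: "flat_alg f \<Longrightarrow> flat_alg g \<Longrightarrow> flat_alg (\<lambda>x. f x + g x)"
| mult: "flat_alg f \<Longrightarrow> flat_alg g \<Longrightarrow> flat_alg (\<lambda>x. f x * g x)"

lemma flat_alg_partial:
  fixes f :: "real^'d \<Rightarrow> real"
  shows "flat_alg f \<Longrightarrow> (\<forall>x. f differentiable (at x)) \<and> (\<forall>i. flat_alg (partial i f))"
proof (induction rule: flat_alg.induct)
  case (const c)
  have "partial i (\<lambda>_. c) = (\<lambda>_::real^'d. 0)" for i :: 'd
    by (rule ext, rule partial_eq) simp
  then show ?case by (simp add: flat_alg.const)
next
  case (flat m s i a)
  let ?f' = "\<lambda>x::real^'d. flat (m + 2) (s * x $ i + a) + - real m * flat (m + 1) (s * x $ i + a)"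
  have d: "((\<lambda>x. flat m (s * x $ i + a)) has_derivative (\<lambda>h. (s * h $ i) * ?f' x)) (at x)" for x :: "real^'d"
  proof -
    have "((\<lambda>x::real^'d. s * x $ i + a) has_derivative (\<lambda>h. s * h $ i)) (at x)"
      by (auto intro!: derivative_eq_intros bounded_linear.has_derivative[OF bounded_linear_vec_nth])
    from has_derivative_compose[OF this DERIV_flat[of m, unfolded has_field_derivative_def]]
    show ?thesis by (simp add: mult.commute algebra_simps)
  qed
  have "partial j (\<lambda>x. flat m (s * x $ i + a)) = (\<lambda>x. (s * axis j 1 $ i) * ?f' x)" for j
    by (rule ext, rule partial_eq[OF d])
  moreover have "flat_alg (\<lambda>x. (s * axis j 1 $ i) * ?f' x)" for j
    by (intro flat_alg.intros)
  ultimately show ?case using d by (auto simp: differentiable_def)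
next
  case (add f g)
  then have "partial i (\<lambda>x. f x + g x) = (\<lambda>x. partial i f x + partial i g x)" for i
    using partial_combine[where f = f and g = g and a = 1 and b = 1] by auto
  then show ?case using add by (auto intro: flat_alg.intros)
next
  case (mult f g)
  then have "partial i (\<lambda>x. f x * g x) = (\<lambda>x. partial i f x * g x + f x * partial i g x)" for i
    by (auto simp: partial_mult)
  then show ?case using mult by (auto intro!: flat_alg.add flat_alg.mult)
qed

lemma Ck_flat_alg: "flat_alg f \<Longrightarrow> Ck n f"
proof (induction n arbitrary: f)
  case 0
  then show ?case
    using flat_alg_partial[OF 0]
    by (auto intro!: differentiable_imp_continuous_on simp: differentiable_on_def)
next
  case (Suc n)
  then show ?case using flat_alg_partial[OF Suc.prems] by auto
qed

section \<open>Smooth bumps on boxes\<close>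

lemma flat_alg_prod: "finite I \<Longrightarrow> (\<And>i. i \<in> I \<Longrightarrow> flat_alg (f i)) \<Longrightarrow> flat_alg (\<lambda>x. \<Prod>i\<in>I. f i x)"
  by (induction I rule: finite_induct) (auto intro: flat_alg.intros)

lemma flat_alg_power: "flat_alg f \<Longrightarrow> flat_alg (\<lambda>x. f x ^ n)"
  by (induction n) (auto intro: flat_alg.intros)

text \<open>The factors \<open>1 * x $ i + - a $ i\<close> and \<open>-1 * x $ i + b $ i\<close> are
  spelled out so that they match the rule \<open>flat_alg.flat\<close>.\<close>

definition box_bump :: "real^'d \<Rightarrow> real^'d \<Rightarrow> real^'d \<Rightarrow> real" where
  "box_bump a b x = (\<Prod>i\<in>UNIV. flat 0 (1 * x $ i + - a $ i) * flat 0 (-1 * x $ i + b $ i))"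

lemma flat_alg_box_bump: "flat_alg (box_bump a b)"
  unfolding box_bump_def by (intro flat_alg_prod flat_alg.intros) auto

lemma flat_0_bounds: "0 \<le> flat 0 t" "flat 0 t \<le> 1" "flat 0 t \<noteq> 0 \<longleftrightarrow> t > 0"
  by (auto simp: flat_def)

lemma box_bump_bounds: "0 \<le> box_bump a b x" "box_bump a b x \<le> 1"
  unfolding box_bump_def
  by (auto intro!: prod_nonneg prod_le_1 mult_nonneg_nonneg mult_le_one flat_0_bounds)

lemma box_bump_eq_0_iff: "box_bump a b x \<noteq> 0 \<longleftrightarrow> x \<in> box a b"
  unfolding box_bump_def using flat_0_bounds(3) by (auto simp: mem_box_cart)

text \<open>Powers of \<open>1 - box_bump a b\<close> tend to 0 where the bump is positive, that is,
  on the open box, and are constantly 1 elsewhere. Their complements to 1 stay polynomials in the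
  bump, hence smooth, and vanish outside the box.\<close>

lemma indicator_box_limit:
  fixes a b :: "real^'d"
  assumes "cbox a b \<subseteq> \<Omega>"
  obtains \<psi> :: "nat \<Rightarrow> real^'d \<Rightarrow> real" where "\<And>n. \<psi> n \<in> test_functions \<Omega>"
    and "\<And>n x. 0 \<le> \<psi> n x" and "\<And>n x. \<psi> n x \<le> 1"
    and "\<And>x. (\<lambda>n. \<psi> n x) \<longlonglongrightarrow> indicator (box a b) x"
proof
  define \<psi> where "\<psi> n x = 1 + (-1) * (1 + (-1) * box_bump a b x) ^ n" for n x
  show "\<psi> n \<in> test_functions \<Omega>" for n
  proof -
    have "flat_alg (\<psi> n)" unfolding \<psi>_def
      by (intro flat_alg.add flat_alg.mult flat_alg.const flat_alg_power flat_alg_box_bump)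
    moreover have "{x. \<psi> n x \<noteq> 0} \<subseteq> cbox a b"
      using box_bump_eq_0_iff[of a b] box_subset_cbox[of a b] by (force simp: \<psi>_def)
    then have "closure {x. \<psi> n x \<noteq> 0} \<subseteq> cbox a b" by (intro closure_minimal) auto
    moreover from this have "compact (closure {x. \<psi> n x \<noteq> 0})"
      using compact_eq_bounded_closed bounded_subset bounded_cbox closed_closure by blast
    ultimately show ?thesis using assms by (auto simp: test_functions_def Ck_flat_alg)
  qed
  have pow: "0 \<le> (1 - box_bump a b x) ^ n" "(1 - box_bump a b x) ^ n \<le> 1" for n x
    using box_bump_bounds[of a b x] by (auto intro: power_le_one)
  show "0 \<le> \<psi> n x" "\<psi> n x \<le> 1" for n x using pow[of x n] by (auto simp: \<psi>_def)
  show "(\<lambda>n. \<psi> n x) \<longlonglongrightarrow> indicator (box a b) x" for x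
  proof (cases "x \<in> box a b")
    case True
    then have "box_bump a b x > 0"
      using box_bump_eq_0_iff[of a b x] box_bump_bounds(1)[of a b x] by linarith
    then have "(\<lambda>n. (1 - box_bump a b x) ^ n) \<longlonglongrightarrow> 0"
      using box_bump_bounds[of a b x] by (intro LIMSEQ_power_zero) auto
    from tendsto_diff[OF tendsto_const this] show ?thesis using True by (simp add: \<psi>_def)
  next
    case False
    then have "box_bump a b x = 0" using box_bump_eq_0_iff by blast
    then show ?thesis using False by (simp add: \<psi>_def)
  qed
qed

section \<open>Integration of partial derivatives\<close>

text \<open>Difference quotients in direction \<open>i\<close> integrate to 0 by translation
  invariance of Lebesgue measure. They converge to the partial derivative, and the mean value
  theorem bounds them by its maximum, so dominated convergence passes to the limit.\<close>

lemma integral_partial_eq_0: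
  fixes f :: "real^'d \<Rightarrow> real"
  assumes diff: "\<And>x. f differentiable (at x)" and cont: "continuous_on UNIV (partial i f)"
    and bdd: "bounded {x. f x \<noteq> 0}"
  shows "(\<integral>x. partial i f x \<partial>lebesgue) = 0"
proof -
  let ?S = "closure {x. f x \<noteq> 0}" and ?e = "axis i 1 :: real^'d"
  have compS: "compact ?S" using bdd by (simp add: compact_closure)
  have "bounded (partial i f ` ?S)"
    using compact_continuous_image[OF continuous_on_subset[OF cont] compS] compact_imp_bounded by auto
  then obtain C0 where C0: "\<And>x. x \<in> ?S \<Longrightarrow> \<bar>partial i f x\<bar> \<le> C0"
    by (auto simp: bounded_iff)
  define C where "C = max C0 0"
  have C: "\<bar>partial i f x\<bar> \<le> C" for x
    using C0[of x] partial_eq_0_outside_closure[of x f i] by (cases "x \<in> ?S") (auto simp: C_def)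
  obtain R where R: "\<And>x. f x \<noteq> 0 \<Longrightarrow> norm x \<le> R" using bdd by (auto simp: bounded_iff)
  have deriv: "((\<lambda>s. f (x + s *\<^sub>R ?e)) has_real_derivative partial i f (x + s *\<^sub>R ?e)) (at s)" for x s
  proof -
    have "((\<lambda>s. x + s *\<^sub>R ?e) has_derivative (\<lambda>h. h *\<^sub>R ?e)) (at s)"
      by (auto intro!: derivative_eq_intros)
    from has_derivative_compose[OF this has_derivative_partial[OF diff]]
    have "((\<lambda>s. f (x + s *\<^sub>R ?e)) has_derivative
        (\<lambda>h. frechet_derivative f (at (x + s *\<^sub>R ?e)) (h *\<^sub>R ?e))) (at s)" .
    moreover have "frechet_derivative f (at (x + s *\<^sub>R ?e)) (h *\<^sub>R ?e) = partial i f (x + s *\<^sub>R ?e) * h" for h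
      using linear_scale[OF linear_frechet_derivative[OF diff]] by (simp add: partial_def)
    ultimately show ?thesis by (simp add: has_field_derivative_def)
  qed
  \<comment> \<open>Shifts of length at most 1 keep the support of every quotient inside the ball of
    radius \<open>R + 1\<close>, which gives an integrable majorant.\<close>
  define t where "t n = inverse (real (Suc n))" for n
  have t: "0 < t n" "t n \<le> 1" for n by (auto simp: t_def field_simps)
  define q where "q n x = (f (x + t n *\<^sub>R ?e) - f x) / t n" for n x
  have contf: "continuous_on UNIV f"
    using diff by (auto intro!: differentiable_imp_continuous_on simp: differentiable_on_def)
  then have measf: "f \<in> borel_measurable borel" by (rule borel_measurable_continuous_onI)
  have ind: "indicator ?S x *\<^sub>R f x = f x" for x
    using closure_subset[of "{x. f x \<noteq> 0}"] by (auto simp: indicator_def)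
  have intf: "integrable lborel f"
    using borel_integrable_compact[OF compS continuous_on_subset[OF contf]] unfolding ind by simp
  have "distr lborel borel ((+) (t n *\<^sub>R ?e)) = lborel" for n
    by (rule lborel_distr_plus)
  then have intft: "integrable lborel (\<lambda>x. f (x + t n *\<^sub>R ?e))"
    and eqt: "(\<integral>x. f (x + t n *\<^sub>R ?e) \<partial>lborel) = (\<integral>x. f x \<partial>lborel)" for n
    using integrable_distr_eq[of "(+) (t n *\<^sub>R ?e)" lborel borel f]
      integral_distr[of "(+) (t n *\<^sub>R ?e)" lborel borel f] intf measf by (auto simp: add.commute)
  have q0: "(\<integral>x. q n x \<partial>lborel) = 0" for n
    unfolding q_def using intft[of n] intf eqt[of n] by simp
  have t0: "t \<longlonglongrightarrow> 0" unfolding t_def by (rule LIMSEQ_inverse_real_of_nat)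
  have "(\<lambda>n. (\<integral>x. q n x \<partial>lborel)) \<longlonglongrightarrow> (\<integral>x. partial i f x \<partial>lborel)"
  proof (rule integral_dominated_convergence[where w = "\<lambda>x. indicator (cball 0 (R + 1)) x *\<^sub>R C"])
    show "partial i f \<in> borel_measurable lborel"
      using borel_measurable_continuous_onI[OF cont] by simp
    show "q n \<in> borel_measurable lborel" for n
      using measf unfolding q_def by measurable
    show "integrable lborel (\<lambda>x::real^'d. indicator (cball 0 (R + 1)) x *\<^sub>R C)"
      by (rule borel_integrable_compact) auto
    show "AE x in lborel. (\<lambda>n. q n x) \<longlonglongrightarrow> partial i f x"
    proof (rule AE_I2)
      fix x
      have "((\<lambda>s. (f (x + s *\<^sub>R ?e) - f x) / s) \<longlongrightarrow> partial i f x) (at 0)"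
        using deriv[of x 0] by (simp add: has_field_derivative_iff)
      moreover have "filterlim t (at 0) sequentially"
        using t0 t(1) by (auto simp: filterlim_at intro!: always_eventually less_imp_neq[symmetric])
      ultimately show "(\<lambda>n. q n x) \<longlonglongrightarrow> partial i f x"
        unfolding q_def by (rule filterlim_compose)
    qed
    show "AE x in lborel. norm (q n x) \<le> indicator (cball 0 (R + 1)) x *\<^sub>R C" for n
    proof (rule AE_I2)
      fix x
      show "norm (q n x) \<le> indicator (cball 0 (R + 1)) x *\<^sub>R C"
      proof (cases "norm x \<le> R + 1")
        case True
        obtain z where "f (x + t n *\<^sub>R ?e) - f (x + 0 *\<^sub>R ?e) = (t n - 0) * partial i f (x + z *\<^sub>R ?e)"
          using MVT2[OF t(1)[of n], where f = "\<lambda>s. f (x + s *\<^sub>R ?e)"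
              and f' = "\<lambda>s. partial i f (x + s *\<^sub>R ?e)"] deriv by blast
        then have "q n x = partial i f (x + z *\<^sub>R ?e)"
          using t(1)[of n] by (simp add: q_def)
        then show ?thesis using C True by simp
      next
        case False
        have "norm x \<le> norm (x + t n *\<^sub>R ?e) + norm (t n *\<^sub>R ?e)"
          using norm_triangle_ineq4[of "x + t n *\<^sub>R ?e" "t n *\<^sub>R ?e"] by simp
        then have "norm (x + t n *\<^sub>R ?e) > R" using False t[of n] by simp
        then have "f (x + t n *\<^sub>R ?e) = 0" "f x = 0" using R False by fastforce+
        then show ?thesis using False by (simp add: q_def)
      qed
    qed
  qed
  then have "(\<integral>x. partial i f x \<partial>lborel) = 0"
    by (simp add: q0 LIMSEQ_const_iff)
  moreover have "(\<integral>x. partial i f x \<partial>lebesgue) = (\<integral>x. partial i f x \<partial>lborel)"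
    by (rule integral_completion) (use borel_measurable_continuous_onI[OF cont] in simp)
  ultimately show ?thesis by simp
qed

section \<open>Square integrable functions\<close>

lemma L2_spaceD:
  assumes "f \<in> L2_space \<Omega>"
  shows "f \<in> borel_measurable (lebesgue_on \<Omega>)" "integrable (lebesgue_on \<Omega>) (\<lambda>x. (f x)\<^sup>2)"
  using assms by (auto simp: L2_space_def)

lemma L2_integrable_mult:
  assumes "f \<in> L2_space \<Omega>" "g \<in> L2_space \<Omega>"
  shows "integrable (lebesgue_on \<Omega>) (\<lambda>x. f x * g x)"
proof (rule Bochner_Integration.integrable_bound)
  note [measurable] = L2_spaceD(1)[OF assms(1)] L2_spaceD(1)[OF assms(2)]
  show "integrable (lebesgue_on \<Omega>) (\<lambda>x. (f x)\<^sup>2 + (g x)\<^sup>2)"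
    using assms by (intro Bochner_Integration.integrable_add L2_spaceD)
  show "(\<lambda>x. f x * g x) \<in> borel_measurable (lebesgue_on \<Omega>)" by measurable
  have "\<bar>f x * g x\<bar> \<le> (f x)\<^sup>2 + (g x)\<^sup>2" for x
    using sum_squares_bound[of "f x" "g x"] sum_squares_bound[of "f x" "- g x"]
      zero_le_power2[of "f x"] zero_le_power2[of "g x"] by (auto simp: abs_le_iff)
  then show "AE x in lebesgue_on \<Omega>. norm (f x * g x) \<le> norm ((f x)\<^sup>2 + (g x)\<^sup>2)"
    by auto
qed

lemma L2_combine:
  assumes "f \<in> L2_space \<Omega>" "g \<in> L2_space \<Omega>"
  shows "(\<lambda>x. a * f x + b * g x) \<in> L2_space \<Omega>"
proof -
  note [measurable] = L2_spaceD(1)[OF assms(1)] L2_spaceD(1)[OF assms(2)]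
  have "integrable (lebesgue_on \<Omega>) (\<lambda>x. a\<^sup>2 * (f x)\<^sup>2 + 2 * a * b * (f x * g x) + b\<^sup>2 * (g x)\<^sup>2)"
    using assms by (intro Bochner_Integration.integrable_add integrable_mult_right L2_spaceD
        L2_integrable_mult)
  also have "(\<lambda>x. a\<^sup>2 * (f x)\<^sup>2 + 2 * a * b * (f x * g x) + b\<^sup>2 * (g x)\<^sup>2) = (\<lambda>x. (a * f x + b * g x)\<^sup>2)"
    by (auto simp: power2_eq_square algebra_simps)
  finally show ?thesis by (simp add: L2_space_def)
qed

lemma L2_zero: "(\<lambda>_. 0) \<in> L2_space \<Omega>"
  by (simp add: L2_space_def)

lemma L2_sum:
  assumes "finite I" "\<And>i. i \<in> I \<Longrightarrow> f i \<in> L2_space \<Omega>"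
  shows "(\<lambda>x. \<Sum>i\<in>I. f i x) \<in> L2_space \<Omega>"
  using assms
proof (induction I rule: finite_induct)
  case (insert i I)
  then show ?case using L2_combine[of "f i" \<Omega> "\<lambda>x. \<Sum>i\<in>I. f i x" 1 1] by simp
qed (simp add: L2_zero)

lemma L2_inner_real: "L2_inner \<Omega> f g = (\<integral>x. f x * g x \<partial>lebesgue_on \<Omega>)"
  for f g :: "real^'d \<Rightarrow> real"
  by (simp add: L2_inner_def)

lemma L2_inner_commute: "L2_inner \<Omega> f g = L2_inner \<Omega> g f"
  by (simp add: L2_inner_def inner_commute)

lemma L2_inner_nonneg: "0 \<le> L2_inner \<Omega> f f"
  by (simp add: L2_inner_def)

lemma L2_norm_power2: "(L2_norm \<Omega> f)\<^sup>2 = L2_inner \<Omega> f f"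
  by (simp add: L2_norm_def L2_inner_nonneg)

lemma L2_inner_combine:
  fixes f g k :: "real^'d \<Rightarrow> real"
  assumes "f \<in> L2_space \<Omega>" "g \<in> L2_space \<Omega>" "k \<in> L2_space \<Omega>"
  shows "L2_inner \<Omega> (\<lambda>x. a * f x + b * g x) k = a * L2_inner \<Omega> f k + b * L2_inner \<Omega> g k"
proof -
  have "L2_inner \<Omega> (\<lambda>x. a * f x + b * g x) k
      = (\<integral>x. a * (f x * k x) + b * (g x * k x) \<partial>lebesgue_on \<Omega>)"
    by (simp add: L2_inner_real algebra_simps)
  also have "\<dots> = a * L2_inner \<Omega> f k + b * L2_inner \<Omega> g k"
    using assms by (simp add: L2_inner_real L2_integrable_mult)
  finally show ?thesis .
qed

lemma L2_inner_cong_AE: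
  fixes f g k :: "real^'d \<Rightarrow> real"
  assumes "f \<in> L2_space \<Omega>" "g \<in> L2_space \<Omega>" "k \<in> L2_space \<Omega>"
    and "AE x in lebesgue_on \<Omega>. f x = g x"
  shows "L2_inner \<Omega> f k = L2_inner \<Omega> g k"
  unfolding L2_inner_real
proof (rule integral_cong_AE)
  note [measurable] = assms(1-3)[THEN L2_spaceD(1)]
  show "(\<lambda>x. f x * k x) \<in> borel_measurable (lebesgue_on \<Omega>)"
    "(\<lambda>x. g x * k x) \<in> borel_measurable (lebesgue_on \<Omega>)" by measurable
qed (use assms(4) in auto)

lemma L2_inner_self_cong_AE:
  fixes f g :: "real^'d \<Rightarrow> real"
  assumes "f \<in> L2_space \<Omega>" "g \<in> L2_space \<Omega>" "AE x in lebesgue_on \<Omega>. f x = g x"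
  shows "L2_inner \<Omega> f f = L2_inner \<Omega> g g"
  using L2_inner_cong_AE[OF assms(1,2,1,3)] L2_inner_cong_AE[OF assms(1,2,2,3)]
  by (simp add: L2_inner_commute)

lemma L2_inner_self_eq_0_AE:
  fixes f :: "real^'d \<Rightarrow> real"
  assumes "f \<in> L2_space \<Omega>" "L2_inner \<Omega> f f = 0"
  shows "AE x in lebesgue_on \<Omega>. f x = 0"
  using integral_nonneg_eq_0_iff_AE[OF L2_spaceD(2)[OF assms(1)]] assms(2)
  by (simp add: L2_inner_real power2_eq_square)

text \<open>\<open>T\<close> stands for a differential operator such as a weak partial derivative, a
  strain entry or the divergence. Linearity up to null sets is all that chosen representatives
  provide, and the integral does not see the difference.\<close>

lemma lin_on_L2_inner_pullback:
  fixes T :: "('a \<Rightarrow> 'b::real_vector) \<Rightarrow> real^'d \<Rightarrow> real"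
  assumes "lin_space W" and "\<And>u. u \<in> W \<Longrightarrow> T u \<in> L2_space \<Omega>"
    and "\<And>u v a b. u \<in> W \<Longrightarrow> v \<in> W \<Longrightarrow>
      AE x in lebesgue_on \<Omega>. T (\<lambda>x. a *\<^sub>R u x + b *\<^sub>R v x) x = a * T u x + b * T v x"
    and "k \<in> L2_space \<Omega>"
  shows "lin_on W (\<lambda>u. L2_inner \<Omega> (T u) k)"
  unfolding lin_on_def
proof (intro ballI allI)
  fix u v and a b :: real
  assume uv: "u \<in> W" "v \<in> W"
  have "L2_inner \<Omega> (T (\<lambda>x. a *\<^sub>R u x + b *\<^sub>R v x)) k = L2_inner \<Omega> (\<lambda>x. a * T u x + b * T v x) k"
    using uv assms by (intro L2_inner_cong_AE L2_combine) (auto intro: lin_spaceD)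
  then show "L2_inner \<Omega> (T (\<lambda>x. a *\<^sub>R u x + b *\<^sub>R v x)) k
      = a * L2_inner \<Omega> (T u) k + b * L2_inner \<Omega> (T v) k"
    using uv assms by (simp add: L2_inner_combine)
qed

lemma semi_inner_pullback:
  fixes T :: "('a \<Rightarrow> 'b::real_vector) \<Rightarrow> real^'d \<Rightarrow> real"
  assumes "lin_space W" and "\<And>u. u \<in> W \<Longrightarrow> T u \<in> L2_space \<Omega>"
    and "\<And>u v a b. u \<in> W \<Longrightarrow> v \<in> W \<Longrightarrow>
      AE x in lebesgue_on \<Omega>. T (\<lambda>x. a *\<^sub>R u x + b *\<^sub>R v x) x = a * T u x + b * T v x"
  shows "semi_inner W (\<lambda>u v. L2_inner \<Omega> (T u) (T v))"
proof
  show "lin_on W (\<lambda>u. L2_inner \<Omega> (T u) (T v))" if "v \<in> W" for v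
    using assms that by (intro lin_on_L2_inner_pullback) auto
qed (use assms(1) in \<open>auto simp: L2_inner_nonneg intro: L2_inner_commute\<close>)

lemma lin_space_L2: "lin_space (L2_space \<Omega>)"
  using L2_zero[of \<Omega>] L2_combine by (auto simp: lin_space_def)

lemma semi_inner_L2: "semi_inner (L2_space \<Omega>) (L2_inner \<Omega>)"
  using semi_inner_pullback[OF lin_space_L2, where T = "\<lambda>u. u"] by simp

lemma L2_inner_vec:
  fixes f g :: "real^'d \<Rightarrow> real^'n"
  assumes "\<And>i. (\<lambda>x. f x $ i) \<in> L2_space \<Omega>" "\<And>i. (\<lambda>x. g x $ i) \<in> L2_space \<Omega>"
  shows "L2_inner \<Omega> f g = (\<Sum>i\<in>UNIV. L2_inner \<Omega> (\<lambda>x. f x $ i) (\<lambda>x. g x $ i))"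
  using assms by (simp add: L2_inner_def inner_vec_def L2_integrable_mult)

lemma L2_inner_mat:
  fixes f g :: "real^'d \<Rightarrow> real^'n^'m"
  assumes "\<And>i j. (\<lambda>x. f x $ i $ j) \<in> L2_space \<Omega>" "\<And>i j. (\<lambda>x. g x $ i $ j) \<in> L2_space \<Omega>"
  shows "L2_inner \<Omega> f g = (\<Sum>i\<in>UNIV. \<Sum>j\<in>UNIV. L2_inner \<Omega> (\<lambda>x. f x $ i $ j) (\<lambda>x. g x $ i $ j))"
  using assms by (simp add: L2_inner_def inner_vec_def L2_integrable_mult)

section \<open>Weak derivatives\<close>

lemma continuous_L2:
  fixes f :: "real^'d \<Rightarrow> real"
  assumes "\<Omega> \<in> sets lebesgue" "continuous_on UNIV f" "compact S" "\<And>x. x \<notin> S \<Longrightarrow> f x = 0"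
  shows "f \<in> L2_space \<Omega>"
proof -
  have meas: "f \<in> borel_measurable borel" using assms(2) by (rule borel_measurable_continuous_onI)
  then have "f \<in> borel_measurable lebesgue" by (auto intro: measurable_completion)
  then have "f \<in> borel_measurable (lebesgue_on \<Omega>)" by (rule measurable_restrict_space1)
  moreover have "integrable lborel (\<lambda>x. indicator S x *\<^sub>R (f x)\<^sup>2)"
    using assms(2,3) by (intro borel_integrable_compact)
      (auto intro!: continuous_intros intro: continuous_on_subset)
  moreover have "(\<lambda>x. indicator S x *\<^sub>R (f x)\<^sup>2) = (\<lambda>x. (f x)\<^sup>2)"
    using assms(4) by (fastforce simp: indicator_def)
  ultimately have "integrable lborel (\<lambda>x. (f x)\<^sup>2)" by (simp only:)
  then have "integrable lebesgue (\<lambda>x. (f x)\<^sup>2)" by (rule integrable_completion[THEN iffD2, rotated])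
      (use meas in simp)
  then have "integrable (lebesgue_on \<Omega>) (\<lambda>x. (f x)\<^sup>2)"
    using assms(1) integrable_mult_indicator[OF assms(1), of "\<lambda>x. (f x)\<^sup>2"]
    by (simp add: integrable_restrict_space)
  then show ?thesis using \<open>f \<in> borel_measurable (lebesgue_on \<Omega>)\<close> by (simp add: L2_space_def)
qed

lemma test_functionsD:
  assumes "\<phi> \<in> test_functions \<Omega>"
  shows "\<phi> differentiable (at x)" "continuous_on UNIV \<phi>" "continuous_on UNIV (partial i \<phi>)"
    "bounded {x. \<phi> x \<noteq> 0}" "x \<notin> \<Omega> \<Longrightarrow> \<phi> x = 0" "x \<notin> \<Omega> \<Longrightarrow> partial i \<phi> x = 0"
proof -
  have Ck: "Ck 0 \<phi>" "Ck (Suc 0) \<phi>" and cl: "compact (closure {x. \<phi> x \<noteq> 0})"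
    "closure {x. \<phi> x \<noteq> 0} \<subseteq> \<Omega>" using assms unfolding test_functions_def by blast+
  show "\<phi> differentiable (at x)" "continuous_on UNIV \<phi>" "continuous_on UNIV (partial i \<phi>)"
    using Ck by simp_all
  show "bounded {x. \<phi> x \<noteq> 0}"
    using cl(1) bounded_subset[OF compact_imp_bounded closure_subset] by blast
  show "x \<notin> \<Omega> \<Longrightarrow> \<phi> x = 0" using cl(2) closure_subset[of "{x. \<phi> x \<noteq> 0}"] by blast
  show "x \<notin> \<Omega> \<Longrightarrow> partial i \<phi> x = 0" using cl(2) by (intro partial_eq_0_outside_closure) auto
qed

lemma test_function_L2:
  assumes "\<Omega> \<in> sets lebesgue" "\<phi> \<in> test_functions \<Omega>"
  shows "\<phi> \<in> L2_space \<Omega>" "partial i \<phi> \<in> L2_space \<Omega>"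
proof -
  have cl: "compact (closure {x. \<phi> x \<noteq> 0})" using assms(2) by (simp add: test_functions_def)
  show "\<phi> \<in> L2_space \<Omega>"
    by (rule continuous_L2[OF assms(1) _ cl])
       (use test_functionsD[OF assms(2)] closure_subset[of "{x. \<phi> x \<noteq> 0}"] in auto)
  show "partial i \<phi> \<in> L2_space \<Omega>"
    by (rule continuous_L2[OF assms(1) _ cl])
       (use test_functionsD[OF assms(2)] partial_eq_0_outside_closure in auto)
qed

lemma zero_test_function: "(\<lambda>_. 0) \<in> test_functions (\<Omega> :: (real^'d) set)"
proof -
  have "Ck n (\<lambda>_::real^'d. 0)" for n using Ck_flat_alg[OF flat_alg.const] .
  then show ?thesis by (simp add: test_functions_def)
qed

lemma test_functions_combine:
  assumes "\<phi> \<in> test_functions \<Omega>" "\<psi> \<in> test_functions \<Omega>"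
  shows "(\<lambda>x. a * \<phi> x + b * \<psi> x) \<in> test_functions \<Omega>"
proof -
  let ?K = "closure {x. \<phi> x \<noteq> 0} \<union> closure {x. \<psi> x \<noteq> 0}"
    and ?S = "closure {x. a * \<phi> x + b * \<psi> x \<noteq> 0}"
  have "{x. a * \<phi> x + b * \<psi> x \<noteq> 0} \<subseteq> {x. \<phi> x \<noteq> 0} \<union> {x. \<psi> x \<noteq> 0}" by auto
  from closure_mono[OF this] have sub: "?S \<subseteq> ?K" unfolding closure_Un .
  have K: "compact ?K" "?K \<subseteq> \<Omega>" using assms by (auto simp: test_functions_def)
  have "compact ?S"
    using bounded_subset[OF compact_imp_bounded[OF K(1)] sub] by (simp add: compact_eq_bounded_closed)
  moreover have "?S \<subseteq> \<Omega>" using sub K(2) by (rule subset_trans)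
  moreover have "Ck n (\<lambda>x. a * \<phi> x + b * \<psi> x)" for n
    using assms by (intro Ck_combine) (auto simp: test_functions_def)
  ultimately show ?thesis by (auto simp: test_functions_def)
qed

lemma integral_lebesgue_on_supported:
  fixes f :: "real^'d \<Rightarrow> real"
  assumes "\<Omega> \<in> sets lebesgue" "\<And>x. x \<notin> \<Omega> \<Longrightarrow> f x = 0"
  shows "(\<integral>x. f x \<partial>lebesgue_on \<Omega>) = (\<integral>x. f x \<partial>lebesgue)"
proof -
  have "(\<lambda>x. indicator \<Omega> x *\<^sub>R f x) = f"
    using assms(2) by (fastforce simp: indicator_def)
  then show ?thesis
    using integral_restrict_space[of \<Omega> lebesgue f] assms(1) by simp
qed

text \<open>Integration by parts: by the product rule the two integrals add up to that of the
  derivative of \<open>\<phi> * \<psi>\<close>, which is 0 by compact support.\<close>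

lemma has_weak_partial_test_function:
  assumes \<Omega>: "\<Omega> \<in> sets lebesgue" and \<phi>: "\<phi> \<in> test_functions \<Omega>"
  shows "has_weak_partial \<Omega> i \<phi> (partial i \<phi>)"
  unfolding has_weak_partial_def
proof (intro conjI ballI)
  show "partial i \<phi> \<in> L2_space \<Omega>" using test_function_L2[OF assms] by blast
  fix \<psi> assume \<psi>: "\<psi> \<in> test_functions \<Omega>"
  note D = test_functionsD[OF \<phi>] test_functionsD[OF \<psi>]
  note L = test_function_L2[OF \<Omega> \<phi>] test_function_L2[OF \<Omega> \<psi>]
  have eq: "partial i (\<lambda>x. \<phi> x * \<psi> x) = (\<lambda>x. partial i \<phi> x * \<psi> x + \<phi> x * partial i \<psi> x)"
    by (rule ext, rule partial_mult) (use D in auto)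
  have "(\<integral>x. partial i (\<lambda>x. \<phi> x * \<psi> x) x \<partial>lebesgue) = 0"
  proof (rule integral_partial_eq_0)
    show "(\<lambda>x. \<phi> x * \<psi> x) differentiable at x" for x
      using D by (intro differentiable_mult) auto
    show "continuous_on UNIV (partial i (\<lambda>x. \<phi> x * \<psi> x))"
      unfolding eq using D by (intro continuous_intros) auto
    show "bounded {x. \<phi> x * \<psi> x \<noteq> 0}"
      by (rule bounded_subset[OF D(4)]) auto
  qed
  then have "(\<integral>x. partial i \<phi> x * \<psi> x + \<phi> x * partial i \<psi> x \<partial>lebesgue_on \<Omega>) = 0"
    unfolding eq using integral_lebesgue_on_supported[OF \<Omega>, of "\<lambda>x. partial i \<phi> x * \<psi> x + \<phi> x * partial i \<psi> x"]
      D by simp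
  then show "L2_inner \<Omega> \<phi> (partial i \<psi>) = - L2_inner \<Omega> (partial i \<phi>) \<psi>"
    using L by (simp add: L2_inner_real L2_integrable_mult)
qed

section \<open>Uniqueness of weak derivatives\<close>

lemma const_L2:
  fixes \<Omega> :: "(real^'d) set"
  assumes "\<Omega> \<in> sets lebesgue" "bounded \<Omega>"
  shows "(\<lambda>_. c) \<in> L2_space \<Omega>"
proof -
  have "\<Omega> \<in> lmeasurable" using assms bounded_set_imp_lmeasurable by blast
  then have "finite_measure (lebesgue_on \<Omega>)" by (rule finite_measure_lebesgue_on)
  then show ?thesis by (simp add: L2_space_def finite_measure.integrable_const)
qed

text \<open>Bounded limits of test functions include indicators of boxes, so the integral of
  \<open>g\<close> over every closed box inside the domain vanishes. Lebesgue differentiation along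
  small cubes with corner \<open>x\<close> then gives \<open>g x = 0\<close> off a negligible
  set.\<close>

lemma fundamental_lemma:
  fixes g :: "real^'d \<Rightarrow> real"
  assumes "open \<Omega>" "bounded \<Omega>" and g: "g \<in> L2_space \<Omega>"
    and orth: "\<And>\<phi>. \<phi> \<in> test_functions \<Omega> \<Longrightarrow> L2_inner \<Omega> g \<phi> = 0"
  shows "AE x in lebesgue_on \<Omega>. g x = 0"
proof -
  have \<Omega>: "\<Omega> \<in> sets lebesgue" using \<open>open \<Omega>\<close> by (simp add: lebesgue_openin borel_open)
  define G where "G = (\<lambda>x. indicator \<Omega> x *\<^sub>R g x)"
  have "integrable (lebesgue_on \<Omega>) g"
    using L2_integrable_mult[OF g const_L2[OF \<Omega> \<open>bounded \<Omega>\<close>, of 1]] by simp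
  then have intG: "integrable lebesgue G"
    using \<Omega> by (simp add: integrable_restrict_space G_def)
  have sint: "set_integrable lebesgue S G" if "S \<in> sets lebesgue" for S
    using intG that integrable_mult_indicator unfolding set_integrable_def by blast
  have zero: "integral (cbox a b) G = 0" if sub: "cbox a b \<subseteq> \<Omega>" for a b
  proof -
    obtain \<psi> :: "nat \<Rightarrow> real^'d \<Rightarrow> real" where \<psi>: "\<And>n. \<psi> n \<in> test_functions \<Omega>"
      "\<And>n x. 0 \<le> \<psi> n x" "\<And>n x. \<psi> n x \<le> 1" "\<And>x. (\<lambda>n. \<psi> n x) \<longlonglongrightarrow> indicator (box a b) x"
      using indicator_box_limit[OF sub] by blast
    have z: "(\<integral>x. \<psi> n x *\<^sub>R G x \<partial>lebesgue) = 0" for n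
    proof -
      have "(\<integral>x. \<psi> n x *\<^sub>R G x \<partial>lebesgue) = (\<integral>x. indicator \<Omega> x *\<^sub>R (g x * \<psi> n x) \<partial>lebesgue)"
        by (simp add: G_def algebra_simps)
      also have "\<dots> = L2_inner \<Omega> g (\<psi> n)"
        using \<Omega> by (simp add: L2_inner_real integral_restrict_space)
      finally show ?thesis using orth[OF \<psi>(1)] by simp
    qed
    have "(\<lambda>n. \<integral>x. \<psi> n x *\<^sub>R G x \<partial>lebesgue) \<longlonglongrightarrow> (\<integral>x. indicator (box a b) x *\<^sub>R G x \<partial>lebesgue)"
    proof (rule integral_dominated_convergence[where w = "\<lambda>x. \<bar>G x\<bar>"])
      have m: "G \<in> borel_measurable lebesgue" using intG by auto
      show "(\<lambda>x. indicator (box a b) x *\<^sub>R G x) \<in> borel_measurable lebesgue"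
        using m by (intro borel_measurable_scaleR borel_measurable_indicator) auto
      show "(\<lambda>x. \<psi> n x *\<^sub>R G x) \<in> borel_measurable lebesgue" for n
      proof (intro borel_measurable_scaleR m)
        have "\<psi> n \<in> borel_measurable borel"
          using test_functionsD(2)[OF \<psi>(1)] by (rule borel_measurable_continuous_onI)
        then show "\<psi> n \<in> borel_measurable lebesgue" by (auto intro: measurable_completion)
      qed
      show "integrable lebesgue (\<lambda>x. \<bar>G x\<bar>)" using intG by simp
      show "AE x in lebesgue. (\<lambda>n. \<psi> n x *\<^sub>R G x) \<longlonglongrightarrow> indicator (box a b) x *\<^sub>R G x"
        using \<psi>(4) by (intro AE_I2 tendsto_intros)
      show "AE x in lebesgue. norm (\<psi> n x *\<^sub>R G x) \<le> \<bar>G x\<bar>" for n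
        using \<psi>(2,3) by (intro AE_I2) (simp add: abs_mult mult_left_le_one_le)
    qed
    then have "(\<integral>x. indicator (box a b) x *\<^sub>R G x \<partial>lebesgue) = 0"
      by (simp only: z LIMSEQ_const_iff)
    moreover have "(\<integral>x. indicator (box a b) x *\<^sub>R G x \<partial>lebesgue) = integral (box a b) G"
      using set_lebesgue_integral_eq_integral(2)[OF sint[of "box a b"]]
      by (simp add: set_lebesgue_integral_def)
    ultimately show ?thesis by (simp add: integral_open_interval)
  qed
  have int: "G integrable_on cbox a b" for a b
    by (rule set_lebesgue_integral_eq_integral(1)[OF sint]) simp
  obtain N where N: "negligible N" and lim: "\<And>x e. \<lbrakk>x \<notin> N; 0 < e\<rbrakk> \<Longrightarrow>
      \<exists>d>0. \<forall>h. 0 < h \<and> h < d \<longrightarrow>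
        norm (integral (cbox x (x + h *\<^sub>R One)) G /\<^sub>R h ^ DIM(real^'d) - G x) < e"
    by (rule integrable_ccontinuous_explicit[of G, OF int], rule that)
  have "g x = 0" if x: "x \<in> \<Omega>" "x \<notin> N" for x
  proof (rule ccontr)
    assume "g x \<noteq> 0"
    then have "norm (G x) > 0" using x by (simp add: G_def)
    from lim[OF x(2) this] obtain d where d: "d > 0" "\<And>h. 0 < h \<Longrightarrow> h < d \<Longrightarrow>
        norm (integral (cbox x (x + h *\<^sub>R One)) G /\<^sub>R h ^ DIM(real^'d) - G x) < norm (G x)"
      by iprover
    obtain r where r: "r > 0" "cball x r \<subseteq> \<Omega>"
      using \<open>open \<Omega>\<close> x(1) open_contains_cball by blast
    \<comment> \<open>A cube of side \<open>h\<close> has diameter \<open>h * norm One\<close>; this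
      \<open>h\<close> fits it into the ball of radius \<open>r\<close> and stays below the
      threshold \<open>d\<close>.\<close>
    define h where "h = min (d / 2) (r / (norm (One :: real^'d) + 1))"
    have pos: "norm (One :: real^'d) + 1 > 0" using norm_ge_zero[of "One :: real^'d"] by linarith
    have h: "0 < h" "h < d" using d(1) r(1) pos by (auto simp: h_def)
    have "h * (norm (One :: real^'d) + 1) \<le> r / (norm (One :: real^'d) + 1) * (norm (One :: real^'d) + 1)"
      using pos by (intro mult_right_mono) (auto simp: h_def)
    also have "\<dots> = r" using pos by simp
    finally have hr: "h * norm (One :: real^'d) \<le> r" using h by (simp add: algebra_simps)
    have "cbox x (x + h *\<^sub>R One) \<subseteq> cball x r"
    proof
      fix y assume y: "y \<in> cbox x (x + h *\<^sub>R One)"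
      have "norm (y - x) \<le> norm (h *\<^sub>R (One :: real^'d))"
      proof (rule norm_le_componentwise)
        fix b :: "real^'d" assume b: "b \<in> Basis"
        then have "x \<bullet> b \<le> y \<bullet> b" "y \<bullet> b \<le> x \<bullet> b + h"
          using y by (auto simp: mem_box inner_add_left)
        then show "\<bar>(y - x) \<bullet> b\<bar> \<le> \<bar>h *\<^sub>R One \<bullet> b\<bar>"
          using b h by (simp add: inner_diff_left)
      qed
      then show "y \<in> cball x r" using hr h by (simp add: dist_norm norm_minus_commute)
    qed
    then have "integral (cbox x (x + h *\<^sub>R One)) G = 0" using r zero by blast
    then show False using d(2)[OF h] by simp
  qed
  then have "AE x in lebesgue. x \<in> \<Omega> \<longrightarrow> g x = 0"
    using N by (intro AE_I'[of N]) (auto simp: negligible_iff_null_sets)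
  then show ?thesis using \<Omega> by (simp add: AE_restrict_space_iff)
qed

text \<open>This makes the choice in \<open>weak_partial\<close> harmless: any explicit weak
  derivative may replace the chosen one almost everywhere.\<close>

lemma weak_partial_unique:
  assumes "open \<Omega>" "bounded \<Omega>" "has_weak_partial \<Omega> i u g" "has_weak_partial \<Omega> i u g'"
  shows "AE x in lebesgue_on \<Omega>. g x = g' x"
proof -
  have \<Omega>: "\<Omega> \<in> sets lebesgue" using \<open>open \<Omega>\<close> by (simp add: lebesgue_openin borel_open)
  have g: "g \<in> L2_space \<Omega>" "g' \<in> L2_space \<Omega>" using assms(3,4) by (auto simp: has_weak_partial_def)
  have "AE x in lebesgue_on \<Omega>. 1 * g x + (-1) * g' x = 0"
  proof (rule fundamental_lemma[OF assms(1,2) L2_combine[OF g]])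
    fix \<phi> assume \<phi>: "\<phi> \<in> test_functions \<Omega>"
    then have "L2_inner \<Omega> g \<phi> = L2_inner \<Omega> g' \<phi>"
      using assms(3,4)[unfolded has_weak_partial_def] by simp
    then show "L2_inner \<Omega> (\<lambda>x. 1 * g x + (-1) * g' x) \<phi> = 0"
      using L2_inner_combine[OF g test_function_L2(1)[OF \<Omega> \<phi>], of 1 "-1"] by simp
  qed
  then show ?thesis by simp
qed

lemma has_weak_partial_combine:
  assumes "\<Omega> \<in> sets lebesgue" "u \<in> L2_space \<Omega>" "v \<in> L2_space \<Omega>"
    and "has_weak_partial \<Omega> i u g" "has_weak_partial \<Omega> i v k"
  shows "has_weak_partial \<Omega> i (\<lambda>x. a * u x + b * v x) (\<lambda>x. a * g x + b * k x)"
  unfolding has_weak_partial_def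
proof (intro conjI ballI)
  have g: "g \<in> L2_space \<Omega>" "k \<in> L2_space \<Omega>"
    using assms(4,5) by (auto simp: has_weak_partial_def)
  show "(\<lambda>x. a * g x + b * k x) \<in> L2_space \<Omega>" by (rule L2_combine[OF g])
  fix \<phi> assume \<phi>: "\<phi> \<in> test_functions \<Omega>"
  note L = test_function_L2[OF assms(1) \<phi>]
  have "L2_inner \<Omega> u (partial i \<phi>) = - L2_inner \<Omega> g \<phi>"
    "L2_inner \<Omega> v (partial i \<phi>) = - L2_inner \<Omega> k \<phi>"
    using assms(4,5) \<phi> by (auto simp: has_weak_partial_def)
  then show "L2_inner \<Omega> (\<lambda>x. a * u x + b * v x) (partial i \<phi>)
      = - L2_inner \<Omega> (\<lambda>x. a * g x + b * k x) \<phi>"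
    by (simp add: L2_inner_combine[OF assms(2,3) L(2)] L2_inner_combine[OF g L(1)])
qed

lemma H1_spaceD:
  assumes "u \<in> H1_space \<Omega>"
  shows "u \<in> L2_space \<Omega>" "has_weak_partial \<Omega> i u (weak_partial \<Omega> i u)"
    "weak_partial \<Omega> i u \<in> L2_space \<Omega>"
proof -
  show "u \<in> L2_space \<Omega>" using assms by (simp add: H1_space_def)
  have "\<exists>g. has_weak_partial \<Omega> i u g" using assms unfolding H1_space_def by blast
  from someI_ex[OF this] show *: "has_weak_partial \<Omega> i u (weak_partial \<Omega> i u)"
    unfolding weak_partial_def .
  then show "weak_partial \<Omega> i u \<in> L2_space \<Omega>" by (simp add: has_weak_partial_def)
qed

section \<open>Sobolev spaces on a bounded open set\<close>

locale bounded_domain =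
  fixes \<Omega> :: "(real^'d) set"
  assumes open_domain: "open \<Omega>" and bounded_domain: "bounded \<Omega>"
begin

lemma domain_sets: "\<Omega> \<in> sets lebesgue"
  using open_domain by (simp add: lebesgue_openin borel_open)

lemma H1_combine:
  assumes "u \<in> H1_space \<Omega>" "v \<in> H1_space \<Omega>"
  shows "(\<lambda>x. a * u x + b * v x) \<in> H1_space \<Omega>"
  unfolding H1_space_def mem_Collect_eq
proof (intro conjI allI)
  show "(\<lambda>x. a * u x + b * v x) \<in> L2_space \<Omega>"
    by (rule L2_combine[OF H1_spaceD(1)[OF assms(1)] H1_spaceD(1)[OF assms(2)]])
  show "\<exists>g. has_weak_partial \<Omega> i (\<lambda>x. a * u x + b * v x) g" for i
    by (rule exI, rule has_weak_partial_combine[OF domain_sets H1_spaceD(1)[OF assms(1)]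
          H1_spaceD(1)[OF assms(2)] H1_spaceD(2)[OF assms(1)] H1_spaceD(2)[OF assms(2)]])
qed

lemma weak_partial_combine:
  assumes "u \<in> H1_space \<Omega>" "v \<in> H1_space \<Omega>"
  shows "AE x in lebesgue_on \<Omega>. weak_partial \<Omega> i (\<lambda>x. a * u x + b * v x) x
    = a * weak_partial \<Omega> i u x + b * weak_partial \<Omega> i v x"
  by (rule weak_partial_unique[OF open_domain bounded_domain H1_spaceD(2)[OF H1_combine[OF assms]]
        has_weak_partial_combine[OF domain_sets H1_spaceD(1)[OF assms(1)] H1_spaceD(1)[OF assms(2)]
          H1_spaceD(2)[OF assms(1)] H1_spaceD(2)[OF assms(2)]]])

lemma test_function_H1:
  assumes "\<phi> \<in> test_functions \<Omega>"
  shows "\<phi> \<in> H1_space \<Omega>"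
  unfolding H1_space_def mem_Collect_eq
proof (intro conjI allI)
  show "\<phi> \<in> L2_space \<Omega>" by (rule test_function_L2(1)[OF domain_sets assms])
  show "\<exists>g. has_weak_partial \<Omega> i \<phi> g" for i
    by (rule exI, rule has_weak_partial_test_function[OF domain_sets assms])
qed

lemma weak_partial_test_function:
  "\<phi> \<in> test_functions \<Omega> \<Longrightarrow> AE x in lebesgue_on \<Omega>. weak_partial \<Omega> i \<phi> x = partial i \<phi> x"
  by (rule weak_partial_unique[OF open_domain bounded_domain H1_spaceD(2)[OF test_function_H1]
        has_weak_partial_test_function[OF domain_sets]])

lemma lin_space_H1: "lin_space (H1_space \<Omega>)"
proof -
  have "(\<lambda>_. 0) \<in> H1_space \<Omega>" by (rule test_function_H1[OF zero_test_function])
  moreover have "(\<lambda>x. a *\<^sub>R u x + b *\<^sub>R v x) \<in> H1_space \<Omega>"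
    if "u \<in> H1_space \<Omega>" "v \<in> H1_space \<Omega>" for u v a b
    using H1_combine[OF that, of a b] by simp
  ultimately show ?thesis unfolding lin_space_def by blast
qed

lemma semi_inner_weak_partial:
  "semi_inner (H1_space \<Omega>) (\<lambda>u v. L2_inner \<Omega> (weak_partial \<Omega> i u) (weak_partial \<Omega> i v))"
  by (rule semi_inner_pullback[OF lin_space_H1 H1_spaceD(3)])
     (simp_all add: weak_partial_combine)

lemma L2_inner_grad:
  assumes "u \<in> H1_space \<Omega>" "v \<in> H1_space \<Omega>"
  shows "L2_inner \<Omega> (grad \<Omega> u) (grad \<Omega> v)
    = (\<Sum>i\<in>UNIV. L2_inner \<Omega> (weak_partial \<Omega> i u) (weak_partial \<Omega> i v))"
  using L2_inner_vec[of "grad \<Omega> u" \<Omega> "grad \<Omega> v"] H1_spaceD(3)[OF assms(1)] H1_spaceD(3)[OF assms(2)]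
  by (simp add: grad_def)

lemma semi_inner_grad: "semi_inner (H1_space \<Omega>) (\<lambda>u v. L2_inner \<Omega> (grad \<Omega> u) (grad \<Omega> v))"
  by (rule semi_inner_cong[OF semi_inner_sum[OF finite semi_inner_weak_partial lin_space_H1]])
     (simp add: L2_inner_grad)

definition H1_inner :: "(real^'d \<Rightarrow> real) \<Rightarrow> (real^'d \<Rightarrow> real) \<Rightarrow> real" where
  "H1_inner u v = 1 * L2_inner \<Omega> u v + 1 * L2_inner \<Omega> (grad \<Omega> u) (grad \<Omega> v)"

lemma semi_inner_H1: "semi_inner (H1_space \<Omega>) H1_inner"
proof -
  interpret L2: semi_inner "L2_space \<Omega>" "L2_inner \<Omega>" by (rule semi_inner_L2)
  have "semi_inner (H1_space \<Omega>) (L2_inner \<Omega>)"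
    using L2.semi_inner_subspace[OF lin_space_H1] H1_spaceD(1) by blast
  from semi_inner_combine[OF this semi_inner_grad, of 1 1] show ?thesis
    by (simp add: H1_inner_def[abs_def])
qed

lemma H1_norm_eq: "H1_norm \<Omega> u = sqrt (H1_inner u u)"
  by (simp add: H1_norm_def H1_inner_def L2_norm_power2)

lemma H1_inner_nonneg: "0 \<le> H1_inner u u"
  by (simp add: H1_inner_def L2_inner_nonneg)

text \<open>Squared norms are values of the form \<open>H1_inner\<close>, to which the rules of
  \<open>semi_inner\<close> apply; a square root does not affect convergence of nonnegative numbers
  to 0.\<close>

lemma H10_space_iff:
  "u \<in> H10_space \<Omega> \<longleftrightarrow> u \<in> H1_space \<Omega> \<and> (\<exists>\<phi>::nat \<Rightarrow> real^'d \<Rightarrow> real. (\<forall>n. \<phi> n \<in> test_functions \<Omega>) \<and>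
     (\<lambda>n. H1_inner (\<lambda>x. u x - \<phi> n x) (\<lambda>x. u x - \<phi> n x)) \<longlonglongrightarrow> 0)"
proof -
  have "(\<lambda>n. sqrt (f n)) \<longlonglongrightarrow> 0 \<longleftrightarrow> f \<longlonglongrightarrow> 0" if f: "\<And>n. 0 \<le> f n" for f :: "nat \<Rightarrow> real"
  proof
    assume "(\<lambda>n. sqrt (f n)) \<longlonglongrightarrow> 0"
    from tendsto_power[OF this, of 2] show "f \<longlonglongrightarrow> 0" using f by simp
  next
    assume "f \<longlonglongrightarrow> 0"
    from tendsto_real_sqrt[OF this] show "(\<lambda>n. sqrt (f n)) \<longlonglongrightarrow> 0" by simp
  qed
  then show ?thesis
    by (simp add: H10_space_def H1_norm_eq H1_inner_nonneg)
qed

lemma H10_combine: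
  assumes "u \<in> H10_space \<Omega>" "v \<in> H10_space \<Omega>"
  shows "(\<lambda>x. a * u x + b * v x) \<in> H10_space \<Omega>"
proof -
  interpret H1: semi_inner "H1_space \<Omega>" H1_inner by (rule semi_inner_H1)
  obtain \<phi> \<psi> where \<phi>: "\<And>n. \<phi> n \<in> test_functions \<Omega>"
      "(\<lambda>n. H1_inner (\<lambda>x. u x - \<phi> n x) (\<lambda>x. u x - \<phi> n x)) \<longlonglongrightarrow> 0"
    and \<psi>: "\<And>n. \<psi> n \<in> test_functions \<Omega>"
      "(\<lambda>n. H1_inner (\<lambda>x. v x - \<psi> n x) (\<lambda>x. v x - \<psi> n x)) \<longlonglongrightarrow> 0"
    and H1: "u \<in> H1_space \<Omega>" "v \<in> H1_space \<Omega>"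
    using assms unfolding H10_space_iff by blast
  define w where "w n x = a * \<phi> n x + b * \<psi> n x" for n x
  define d where "d n x = (a * u x + b * v x) - w n x" for n x
  have le: "H1_inner (d n) (d n) \<le> 2 * a\<^sup>2 * H1_inner (\<lambda>x. u x - \<phi> n x) (\<lambda>x. u x - \<phi> n x)
      + 2 * b\<^sup>2 * H1_inner (\<lambda>x. v x - \<psi> n x) (\<lambda>x. v x - \<psi> n x)" for n
  proof -
    have "d n = (\<lambda>x. a *\<^sub>R (u x - \<phi> n x) + b *\<^sub>R (v x - \<psi> n x))"
      by (auto simp: d_def w_def algebra_simps)
    then show ?thesis
      using H1.combine_self_le[of "\<lambda>x. u x - \<phi> n x" "\<lambda>x. v x - \<psi> n x" a b]
        lin_space_diff[OF lin_space_H1 H1(1) test_function_H1[OF \<phi>(1)[of n]]]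
        lin_space_diff[OF lin_space_H1 H1(2) test_function_H1[OF \<psi>(1)[of n]]] by simp
  qed
  have "(\<lambda>n. H1_inner (d n) (d n)) \<longlonglongrightarrow> 0"
  proof (rule tendsto_sandwich[OF _ _ tendsto_const])
    show "(\<lambda>n. 2 * a\<^sup>2 * H1_inner (\<lambda>x. u x - \<phi> n x) (\<lambda>x. u x - \<phi> n x)
      + 2 * b\<^sup>2 * H1_inner (\<lambda>x. v x - \<psi> n x) (\<lambda>x. v x - \<psi> n x)) \<longlonglongrightarrow> 0"
      using tendsto_add[OF tendsto_mult_right_zero[OF \<phi>(2)] tendsto_mult_right_zero[OF \<psi>(2)]] by simp
  qed (auto simp: le H1_inner_nonneg)
  moreover have "w n \<in> test_functions \<Omega>" for n
    unfolding w_def by (rule test_functions_combine[OF \<phi>(1) \<psi>(1)])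
  ultimately show ?thesis
    unfolding H10_space_iff using H1_combine[OF H1] by (auto simp: d_def[abs_def])
qed

text \<open>The integral of \<open>\<partial>\<^sub>i (x\<^sub>i \<phi>\<^sup>2) = \<phi>\<^sup>2 + 2 x\<^sub>i \<phi> \<partial>\<^sub>i \<phi>\<close> vanishes.\<close>

lemma poincare_test_function:
  assumes \<phi>: "\<phi> \<in> test_functions \<Omega>" and R: "\<And>x. x \<in> \<Omega> \<Longrightarrow> norm x \<le> R"
  shows "L2_inner \<Omega> \<phi> \<phi> \<le> 4 * R\<^sup>2 * L2_inner \<Omega> (partial i \<phi>) (partial i \<phi>)"
proof -
  note D = test_functionsD[OF \<phi>] and L = test_function_L2[OF domain_sets \<phi>]
  have L': "(\<lambda>x. x $ i * \<phi> x) \<in> L2_space \<Omega>"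
    by (rule continuous_L2[OF domain_sets, where S = "closure {x. \<phi> x \<noteq> 0}"])
       (use \<phi> D closure_subset[of "{x. \<phi> x \<noteq> 0}"] in \<open>auto simp: test_functions_def intro!: continuous_intros\<close>)
  have dx: "((\<lambda>x::real^'d. x $ i) has_derivative (\<lambda>h. h $ i)) (at x)" for x
    by (intro bounded_linear.has_derivative[OF bounded_linear_vec_nth] has_derivative_ident)
  then have dx': "(\<lambda>x::real^'d. x $ i) differentiable (at x)" for x
    by (auto simp: differentiable_def)
  let ?g = "\<lambda>x. \<phi> x * \<phi> x + 2 * (x $ i * \<phi> x * partial i \<phi> x)"
  have eq: "partial i (\<lambda>x. x $ i * (\<phi> x * \<phi> x)) = ?g"
  proof
    fix x
    show "partial i (\<lambda>x. x $ i * (\<phi> x * \<phi> x)) x = ?g x"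
      using D(1) dx' partial_eq[OF dx, of i x]
      by (subst partial_mult) (auto simp: partial_mult algebra_simps intro!: differentiable_mult)
  qed
  have "(\<integral>x. partial i (\<lambda>x. x $ i * (\<phi> x * \<phi> x)) x \<partial>lebesgue) = 0"
  proof (rule integral_partial_eq_0)
    show "(\<lambda>x. x $ i * (\<phi> x * \<phi> x)) differentiable at x" for x
      using D(1) dx' by (intro differentiable_mult)
    show "continuous_on UNIV (partial i (\<lambda>x. x $ i * (\<phi> x * \<phi> x)))"
      unfolding eq using D(2,3) by (intro continuous_intros)
    show "bounded {x. x $ i * (\<phi> x * \<phi> x) \<noteq> 0}"
      by (rule bounded_subset[OF D(4)]) auto
  qed
  then have "(\<integral>x. ?g x \<partial>lebesgue_on \<Omega>) = 0"
    unfolding eq using integral_lebesgue_on_supported[OF domain_sets, of ?g] D(5) by simp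
  moreover have "(\<integral>x. ?g x \<partial>lebesgue_on \<Omega>)
      \<ge> (\<integral>x. (1/2) * (\<phi> x * \<phi> x) - 2 * R\<^sup>2 * (partial i \<phi> x * partial i \<phi> x) \<partial>lebesgue_on \<Omega>)"
  proof (rule integral_mono)
    show "integrable (lebesgue_on \<Omega>) ?g"
      using L L' by (intro Bochner_Integration.integrable_add integrable_mult_right L2_integrable_mult)
    show "integrable (lebesgue_on \<Omega>)
        (\<lambda>x. (1/2) * (\<phi> x * \<phi> x) - 2 * R\<^sup>2 * (partial i \<phi> x * partial i \<phi> x))"
      using L by (intro Bochner_Integration.integrable_diff integrable_mult_right L2_integrable_mult)
    fix x assume "x \<in> space (lebesgue_on \<Omega>)"
    then have "norm x \<le> R" using R by simp
    then have "\<bar>x $ i\<bar> \<le> R" using component_le_norm_cart[of x i] by linarith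
    then have "(x $ i)\<^sup>2 \<le> R\<^sup>2" by (rule power2_le_iff_abs_le[THEN iffD2, rotated]) (use \<open>\<bar>x $ i\<bar> \<le> R\<close> in linarith)
    then have "(x $ i)\<^sup>2 * (partial i \<phi> x)\<^sup>2 \<le> R\<^sup>2 * (partial i \<phi> x)\<^sup>2"
      by (rule mult_right_mono) simp
    \<comment> \<open>Young's inequality for the mixed term: half of this square shows that
      \<open>2 * x $ i * \<phi> x * partial i \<phi> x\<close> costs at most half of the squared
      value of \<open>\<phi>\<close>.\<close>
    moreover have "0 \<le> (\<phi> x + 2 * (x $ i * partial i \<phi> x))\<^sup>2" by simp
    ultimately show "(1/2) * (\<phi> x * \<phi> x) - 2 * R\<^sup>2 * (partial i \<phi> x * partial i \<phi> x) \<le> ?g x"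
      by (simp add: power2_eq_square algebra_simps)
  qed
  ultimately have "(1/2) * L2_inner \<Omega> \<phi> \<phi> - 2 * R\<^sup>2 * L2_inner \<Omega> (partial i \<phi>) (partial i \<phi>) \<le> 0"
    using L by (simp add: L2_inner_real L2_integrable_mult)
  then show ?thesis by simp
qed

text \<open>Poincare's inequality is available for the approximating test functions only. As the
  derivative of \<open>u\<close> vanishes, that of \<open>\<phi> n\<close> is minus the derivative
  of the error \<open>u - \<phi> n\<close> and tends to 0; hence so does \<open>\<phi> n\<close>,
  while also approximating \<open>u\<close>.\<close>

lemma H10_eq_0_if_weak_partial_eq_0:
  assumes u: "u \<in> H10_space \<Omega>" and z: "AE x in lebesgue_on \<Omega>. weak_partial \<Omega> i u x = 0"
  shows "L2_inner \<Omega> u u = 0"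
proof -
  interpret L2: semi_inner "L2_space \<Omega>" "L2_inner \<Omega>" by (rule semi_inner_L2)
  obtain \<phi> where \<phi>: "\<And>n. \<phi> n \<in> test_functions \<Omega>"
      "(\<lambda>n. H1_inner (\<lambda>x. u x - \<phi> n x) (\<lambda>x. u x - \<phi> n x)) \<longlonglongrightarrow> 0"
    and H1: "u \<in> H1_space \<Omega>"
    using u unfolding H10_space_iff by blast
  obtain R where R: "\<And>x. x \<in> \<Omega> \<Longrightarrow> norm x \<le> R"
    using bounded_domain by (auto simp: bounded_iff)
  \<comment> \<open>The splitting of \<open>u\<close> into error and approximant doubles both
    squares; with Poincare's factor \<open>4 * R\<^sup>2\<close> this gives
    \<open>2 + 8 * R\<^sup>2\<close>.\<close>
  have le: "L2_inner \<Omega> u u \<le> (2 + 8 * R\<^sup>2) * H1_inner (\<lambda>x. u x - \<phi> n x) (\<lambda>x. u x - \<phi> n x)" for n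
  proof -
    let ?e = "\<lambda>x. u x - \<phi> n x"
    have \<phi>H: "\<phi> n \<in> H1_space \<Omega>" using test_function_H1 \<phi>(1) .
    have eH: "?e \<in> H1_space \<Omega>" using lin_space_diff[OF lin_space_H1 H1 \<phi>H] .
    note L = test_function_L2[OF domain_sets \<phi>(1)[of n]]
    have "AE x in lebesgue_on \<Omega>. weak_partial \<Omega> i ?e x = - partial i (\<phi> n) x"
      using weak_partial_combine[OF H1 \<phi>H, of i 1 "-1"] weak_partial_test_function[OF \<phi>(1)[of n], of i] z
      by eventually_elim simp
    then have "L2_inner \<Omega> (weak_partial \<Omega> i ?e) (weak_partial \<Omega> i ?e)
        = L2_inner \<Omega> (\<lambda>x. - partial i (\<phi> n) x) (\<lambda>x. - partial i (\<phi> n) x)"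
      using H1_spaceD[OF eH] L2_combine[OF L(2)[of i] L2_zero, of "-1" 0]
      by (intro L2_inner_self_cong_AE) auto
    then have "L2_inner \<Omega> (partial i (\<phi> n)) (partial i (\<phi> n))
        = L2_inner \<Omega> (weak_partial \<Omega> i ?e) (weak_partial \<Omega> i ?e)"
      by (simp add: L2_inner_def)
    also have "\<dots> \<le> L2_inner \<Omega> (grad \<Omega> ?e) (grad \<Omega> ?e)"
      unfolding L2_inner_grad[OF eH eH]
      by (rule member_le_sum) (auto simp: L2_inner_nonneg)
    finally have p: "L2_inner \<Omega> (partial i (\<phi> n)) (partial i (\<phi> n)) \<le> H1_inner ?e ?e"
      using L2_inner_nonneg[of \<Omega> ?e] by (simp add: H1_inner_def)
    have e: "L2_inner \<Omega> ?e ?e \<le> H1_inner ?e ?e"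
      using L2_inner_nonneg[of \<Omega> "grad \<Omega> ?e"] by (simp add: H1_inner_def)
    have "L2_inner \<Omega> u u \<le> 2 * L2_inner \<Omega> ?e ?e + 2 * L2_inner \<Omega> (\<phi> n) (\<phi> n)"
      using L2.combine_self_le[OF H1_spaceD(1)[OF eH] L(1), of 1 1] by simp
    also have "\<dots> \<le> 2 * H1_inner ?e ?e + 2 * (4 * R\<^sup>2 * H1_inner ?e ?e)"
      using e poincare_test_function[OF \<phi>(1)[of n] R, of i] mult_left_mono[OF p, of "4 * R\<^sup>2"] by simp
    finally show ?thesis by (simp add: algebra_simps)
  qed
  have "L2_inner \<Omega> u u \<le> 0"
    by (rule LIMSEQ_le_const[OF tendsto_mult_right_zero[OF \<phi>(2)]]) (use le in blast)
  then show ?thesis using L2_inner_nonneg[of \<Omega> u] by simp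
qed

end

section \<open>Finite-element spaces\<close>

text \<open>Continuity makes the set where \<open>u\<close> is nonzero open, and a nonempty open set
  is not negligible. This is what continuous representatives extended by zero are good for: equality
  almost everywhere becomes equality.\<close>

lemma open_AE_zero_imp_zero:
  fixes u :: "real^'d \<Rightarrow> real"
  assumes "open \<Omega>" "continuous_on UNIV u" "\<And>x. x \<notin> \<Omega> \<Longrightarrow> u x = 0"
    and "AE x in lebesgue_on \<Omega>. u x = 0"
  shows "u = (\<lambda>_. 0)"
proof -
  let ?U = "{x. u x \<noteq> 0}"
  have \<Omega>: "\<Omega> \<in> sets lebesgue" using \<open>open \<Omega>\<close> by (simp add: lebesgue_openin borel_open)
  have "open ?U"
    using open_vimage[OF open_Compl[OF closed_singleton] assms(2), of 0]
    by (simp add: vimage_def Compl_eq)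
  have "AE x in lebesgue. x \<in> \<Omega> \<longrightarrow> u x = 0"
    using assms(4) \<Omega> by (simp add: AE_restrict_space_iff)
  then have "AE x in lebesgue. u x = 0"
    by (rule eventually_mono) (use assms(3) in blast)
  then obtain N where N: "{x \<in> space lebesgue. \<not> u x = 0} \<subseteq> N" "emeasure lebesgue N = 0"
    "N \<in> sets lebesgue" by (rule AE_E)
  have "negligible N" using null_setsI[OF N(2,3)] by (simp add: negligible_iff_null_sets)
  then have "negligible ?U" by (rule negligible_subset) (use N(1) in simp)
  then have "?U = {}" using open_not_negligible[OF \<open>open ?U\<close>] by blast
  then show ?thesis by auto
qed

section \<open>Affine functions and bubbles on a simplex\<close>

lemma affine_fun_combine:
  "affine_fun p \<Longrightarrow> affine_fun q \<Longrightarrow> affine_fun (\<lambda>x. a * p x + b * q x)"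
proof -
  assume "affine_fun p" "affine_fun q"
  then obtain c d c' d' where "\<And>x. p x = c \<bullet> x + d" "\<And>x. q x = c' \<bullet> x + d'"
    unfolding affine_fun_def by blast
  then have "\<forall>x. a * p x + b * q x = (a *\<^sub>R c + b *\<^sub>R c') \<bullet> x + (a * d + b * d')"
    by (simp add: inner_add_left algebra_simps)
  then show ?thesis unfolding affine_fun_def by blast
qed

lemma affine_fun_zero: "affine_fun (\<lambda>_. 0)"
  unfolding affine_fun_def by (intro exI[of _ 0]) simp

lemma affine_fun_eq_0_on_convex_hull:
  assumes "affine_fun p" "\<And>x. x \<in> C \<Longrightarrow> p x = 0" "x \<in> convex hull C"
  shows "p x = 0"
proof -
  obtain c d where p: "\<And>x. p x = c \<bullet> x + d" using assms(1) unfolding affine_fun_def by blast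
  have "{x. p x = 0} = {x. c \<bullet> x = - d}" by (auto simp: p)
  then have "convex {x. p x = 0}" by (simp add: convex_hyperplane)
  then have "convex hull C \<subseteq> {x. p x = 0}" using assms(2) by (intro hull_minimal) auto
  then show ?thesis using assms(3) by blast
qed

text \<open>The vertices of the simplex serve as points. The proviso \<open>x \<in> T\<close>
  reflects that a finite-element function agrees with its local polynomial on \<open>T\<close>
  only.\<close>

lemma finite_separating_local_P1:
  fixes T :: "(real^'d) set"
  assumes "n simplex T"
  shows "\<exists>X. finite X \<and> (\<forall>p\<in>local_P1 T. (\<forall>x\<in>X. x \<in> T \<longrightarrow> p x = 0) \<longrightarrow> (\<forall>x\<in>T. p x = 0))"
proof -
  obtain C where C: "\<not> affine_dependent C" "T = convex hull C"
    using assms unfolding simplex_def by blast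
  have "C \<subseteq> T" unfolding C(2) by (rule hull_subset)
  show ?thesis
  proof (intro exI[of _ C] conjI ballI impI)
    show "finite C" by (rule aff_independent_finite[OF C(1)])
    fix p x assume "p \<in> local_P1 T" "\<forall>x\<in>C. x \<in> T \<longrightarrow> p x = 0" "x \<in> T"
    then show "p x = 0"
      using affine_fun_eq_0_on_convex_hull[of p C x] \<open>C \<subseteq> T\<close> C(2) by (auto simp: local_P1_def)
  qed
qed

text \<open>The bubble enlarges the affine functions by at most one dimension, so one further point
  is enough.\<close>

lemma finite_separating_local_P1_bubble:
  fixes T :: "(real^'d) set"
  assumes "n simplex T"
  shows "\<exists>X. finite X \<and> (\<forall>p\<in>local_P1_bubble T. (\<forall>x\<in>X. x \<in> T \<longrightarrow> p x = 0) \<longrightarrow> (\<forall>x\<in>T. p x = 0))"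
proof -
  obtain X where X: "finite X"
    "\<And>p x. affine_fun p \<Longrightarrow> (\<forall>x\<in>X. x \<in> T \<longrightarrow> p x = 0) \<Longrightarrow> x \<in> T \<Longrightarrow> p x = 0"
    using finite_separating_local_P1[OF assms] unfolding local_P1_def by blast
  let ?b = "bubble T"
  show ?thesis
  proof (cases "\<exists>p0 x0. affine_fun p0 \<and> (\<forall>x\<in>X. x \<in> T \<longrightarrow> p0 x + ?b x = 0) \<and> x0 \<in> T \<and> p0 x0 + ?b x0 \<noteq> 0")
    case True
    then obtain p0 x0 where p0: "affine_fun p0" "\<And>x. x \<in> X \<Longrightarrow> x \<in> T \<Longrightarrow> p0 x + ?b x = 0"
      and x0: "x0 \<in> T" "p0 x0 + ?b x0 \<noteq> 0" by blast
    have "p x + c * ?b x = 0"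
      if p: "affine_fun p" and v: "\<forall>x\<in>insert x0 X. x \<in> T \<longrightarrow> p x + c * ?b x = 0" and x: "x \<in> T" for p c x
    proof -
      \<comment> \<open>A combination vanishing on \<open>X\<close> differs on \<open>T\<close> from
        \<open>c * (p0 + bubble T)\<close> by an affine function that vanishes on \<open>X\<close>,
        hence on \<open>T\<close>. The extra point \<open>x0\<close> then forces
        \<open>c = 0\<close>.\<close>
      have aff: "affine_fun (\<lambda>x. 1 * p x + (- c) * p0 x)" by (rule affine_fun_combine[OF p p0(1)])
      have "1 * p y + (- c) * p0 y = 0" if y: "y \<in> T" for y
      proof (rule X(2)[OF aff _ y], intro ballI impI)
        fix z assume z: "z \<in> X" "z \<in> T"
        have "p z + c * ?b z = 0" using v z by blast
        moreover have "c * (p0 z + ?b z) = 0" using p0(2)[OF z] by simp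
        ultimately show "1 * p z + (- c) * p0 z = 0" by (simp add: algebra_simps)
      qed
      then have eq: "p y + c * ?b y = c * (p0 y + ?b y)" if "y \<in> T" for y
        using that by (simp add: algebra_simps)
      have "c = 0" using eq[OF x0(1)] v x0 by simp
      then show ?thesis using eq[OF x] by simp
    qed
    then show ?thesis
      using X(1) by (intro exI[of _ "insert x0 X"]) (auto simp: local_P1_bubble_def)
  next
    case False
    have "p x + c * ?b x = 0"
      if p: "affine_fun p" and v: "\<forall>x\<in>X. x \<in> T \<longrightarrow> p x + c * ?b x = 0" and x: "x \<in> T" for p c x
    proof (cases "c = 0")
      case True
      then show ?thesis using X(2)[OF p _ x] v by simp
    next
      case c: False
      \<comment> \<open>Division by \<open>c\<close> normalizes the bubble coefficient to 1, the
        situation that the case distinction excludes.\<close>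
      have aff: "affine_fun (\<lambda>x. (1 / c) * p x + 0 * p x)" by (rule affine_fun_combine[OF p p])
      have "\<forall>x\<in>X. x \<in> T \<longrightarrow> (1 / c * p x + 0 * p x) + ?b x = 0"
        using v c by (simp add: field_simps)
      then have "(1 / c * p x + 0 * p x) + ?b x = 0"
        using False aff x by blast
      then show ?thesis using c by (simp add: field_simps)
    qed
    then show ?thesis
      using X(1) by (intro exI[of _ X]) (auto simp: local_P1_bubble_def)
  qed
qed

lemma local_P1_combine:
  "p \<in> local_P1 T \<Longrightarrow> q \<in> local_P1 T \<Longrightarrow> (\<lambda>x. a * p x + b * q x) \<in> local_P1 T"
  by (simp add: local_P1_def affine_fun_combine)

lemma local_P1_bubble_combine:
  assumes "p \<in> local_P1_bubble T" "q \<in> local_P1_bubble T"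
  shows "(\<lambda>x. a * p x + b * q x) \<in> local_P1_bubble T"
proof -
  obtain p' c q' d where p: "p = (\<lambda>x. p' x + c * bubble T x)" "affine_fun p'"
    and q: "q = (\<lambda>x. q' x + d * bubble T x)" "affine_fun q'"
    using assms unfolding local_P1_bubble_def by blast
  have "(\<lambda>x. a * p x + b * q x) = (\<lambda>x. (a * p' x + b * q' x) + (a * c + b * d) * bubble T x)"
    by (simp add: p q algebra_simps)
  then show ?thesis
    using affine_fun_combine[OF p(2) q(2), of a b]
    unfolding local_P1_bubble_def mem_Collect_eq by (intro exI conjI)
qed

text \<open>The properties shared by the two scalar finite-element spaces. \<open>separating\<close>
  encodes finite dimension through point evaluations; \<open>definite\<close> distinguishes
  functions from classes modulo null sets.\<close>

locale conforming_space = bounded_domain \<Omega> for \<Omega> :: "(real^'d) set" +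
  fixes F :: "(real^'d \<Rightarrow> real) set"
  assumes lin_space: "lin_space F"
    and F_H10: "F \<subseteq> H10_space \<Omega>"
    and definite: "u \<in> F \<Longrightarrow> L2_inner \<Omega> u u = 0 \<Longrightarrow> u = (\<lambda>_. 0)"
    and separating: "\<exists>X. finite X \<and> (\<forall>u\<in>F. (\<forall>x\<in>X. u x = 0) \<longrightarrow> u = (\<lambda>_. 0))"

section \<open>Piecewise polynomial spaces are conforming\<close>

context bounded_domain
begin

lemma H10_zero: "(\<lambda>_. 0) \<in> H10_space \<Omega>"
proof -
  interpret H1: semi_inner "H1_space \<Omega>" H1_inner by (rule semi_inner_H1)
  note z = zero_test_function[of \<Omega>]
  have "H1_inner (\<lambda>_. 0) (\<lambda>_. 0) = 0"
    by (rule lin_on_zero[OF H1.space H1.lin[OF test_function_H1[OF z]]])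
  then show ?thesis
    unfolding H10_space_iff using z test_function_H1[OF z] by (intro conjI exI[of _ "\<lambda>n x. 0"]) auto
qed

text \<open>A member vanishes off the mesh and is local on each element, so the separating points of
  all elements together determine it; finiteness of the mesh keeps their number finite.\<close>

lemma conforming_space_fe_space:
  assumes combine: "\<And>T p q a b. p \<in> P T \<Longrightarrow> q \<in> P T \<Longrightarrow> (\<lambda>x. a * p x + b * q x) \<in> P T"
    and zero: "\<And>T. (\<lambda>_. 0) \<in> P T" and fin: "finite \<T>"
    and sep: "\<And>T. T \<in> \<T> \<Longrightarrow>
      \<exists>X. finite X \<and> (\<forall>p\<in>P T. (\<forall>x\<in>X. x \<in> T \<longrightarrow> p x = 0) \<longrightarrow> (\<forall>x\<in>T. p x = 0))"
  shows "conforming_space \<Omega> (fe_space \<Omega> \<T> P)"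
proof
  have "(\<lambda>x. a * u x + b * v x) \<in> fe_space \<Omega> \<T> P"
    if u: "u \<in> fe_space \<Omega> \<T> P" and v: "v \<in> fe_space \<Omega> \<T> P" for u v a b
    unfolding fe_space_def mem_Collect_eq
  proof (intro conjI ballI allI impI)
    show "(\<lambda>x. a * u x + b * v x) \<in> H10_space \<Omega>"
      using u v by (intro H10_combine) (auto simp: fe_space_def)
    show "continuous_on UNIV (\<lambda>x. a * u x + b * v x)"
      using u v by (intro continuous_intros) (auto simp: fe_space_def)
    show "a * u x + b * v x = 0" if "x \<notin> \<Omega> \<inter> \<Union>\<T>" for x
      using u v that by (simp add: fe_space_def)
    fix T assume "T \<in> \<T>"
    then obtain p q where "p \<in> P T" "q \<in> P T" "\<forall>x\<in>T. u x = p x" "\<forall>x\<in>T. v x = q x"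
      using u v unfolding fe_space_def by blast
    then show "\<exists>p\<in>P T. \<forall>x\<in>T. a * u x + b * v x = p x"
      using combine[of p T q a b] by (intro bexI[of _ "\<lambda>x. a * p x + b * q x"]) auto
  qed
  moreover have "(\<lambda>_. 0) \<in> fe_space \<Omega> \<T> P"
    unfolding fe_space_def using H10_zero zero by (auto intro: bexI[of _ "\<lambda>_. 0"])
  ultimately show "lin_space (fe_space \<Omega> \<T> P)"
    unfolding lin_space_def real_scaleR_def by blast
  show "fe_space \<Omega> \<T> P \<subseteq> H10_space \<Omega>" by (auto simp: fe_space_def)
  show "u = (\<lambda>_. 0)" if u: "u \<in> fe_space \<Omega> \<T> P" and z: "L2_inner \<Omega> u u = 0" for u
  proof (rule open_AE_zero_imp_zero[OF open_domain])
    show "continuous_on UNIV u" "\<And>x. x \<notin> \<Omega> \<Longrightarrow> u x = 0" using u by (auto simp: fe_space_def)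
    have "u \<in> L2_space \<Omega>" using u by (auto simp: fe_space_def H10_space_def H1_space_def)
    then show "AE x in lebesgue_on \<Omega>. u x = 0" using z by (rule L2_inner_self_eq_0_AE)
  qed
  obtain X where X: "\<And>T. T \<in> \<T> \<Longrightarrow> finite (X T)"
    "\<And>T p x. T \<in> \<T> \<Longrightarrow> p \<in> P T \<Longrightarrow> \<forall>x\<in>X T. x \<in> T \<longrightarrow> p x = 0 \<Longrightarrow> x \<in> T \<Longrightarrow> p x = 0"
    using sep by metis
  show "\<exists>X. finite X \<and> (\<forall>u\<in>fe_space \<Omega> \<T> P. (\<forall>x\<in>X. u x = 0) \<longrightarrow> u = (\<lambda>_. 0))"
  proof (intro exI[of _ "\<Union>T\<in>\<T>. X T"] conjI ballI impI ext)
    show "finite (\<Union>T\<in>\<T>. X T)" using fin X(1) by blast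
    fix u x assume u: "u \<in> fe_space \<Omega> \<T> P" and z: "\<forall>x\<in>\<Union>T\<in>\<T>. X T. u x = 0"
    show "u x = 0"
    proof (cases "x \<in> \<Union>\<T>")
      case True
      then obtain T where T: "T \<in> \<T>" "x \<in> T" by blast
      obtain p where p: "p \<in> P T" "\<forall>x\<in>T. u x = p x" using u T unfolding fe_space_def by blast
      have "\<forall>x\<in>X T. x \<in> T \<longrightarrow> p x = 0" using z p(2) T(1) by force
      then show ?thesis using X(2)[OF T(1) p(1) _ T(2)] p(2) T(2) by simp
    next
      case False
      then show ?thesis using u by (simp add: fe_space_def)
    qed
  qed
qed

lemma conforming_space_P1:
  assumes "mesh \<Omega> \<T> h"
  shows "conforming_space \<Omega> (fe_space \<Omega> \<T> local_P1)"
proof (rule conforming_space_fe_space[OF local_P1_combine])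
  show "(\<lambda>_. 0) \<in> local_P1 T" for T by (simp add: local_P1_def affine_fun_zero)
  show "finite \<T>" using assms by (simp add: mesh_def triangulation_def)
  show "\<exists>X. finite X \<and> (\<forall>p\<in>local_P1 T. (\<forall>x\<in>X. x \<in> T \<longrightarrow> p x = 0) \<longrightarrow> (\<forall>x\<in>T. p x = 0))"
    if "T \<in> \<T>" for T
    by (rule finite_separating_local_P1) (use assms that in \<open>auto simp: mesh_def\<close>)
qed

lemma conforming_space_P1_bubble:
  assumes "mesh \<Omega> \<T> h"
  shows "conforming_space \<Omega> (fe_space \<Omega> \<T> local_P1_bubble)"
proof (rule conforming_space_fe_space[OF local_P1_bubble_combine])
  show "(\<lambda>_. 0) \<in> local_P1_bubble T" for T
    unfolding local_P1_bubble_def using affine_fun_zero by (auto intro!: exI[of _ "\<lambda>_. 0"] exI[of _ 0])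
  show "finite \<T>" using assms by (simp add: mesh_def triangulation_def)
  show "\<exists>X. finite X \<and> (\<forall>p\<in>local_P1_bubble T. (\<forall>x\<in>X. x \<in> T \<longrightarrow> p x = 0) \<longrightarrow> (\<forall>x\<in>T. p x = 0))"
    if "T \<in> \<T>" for T
    by (rule finite_separating_local_P1_bubble) (use assms that in \<open>auto simp: mesh_def\<close>)
qed

end

section \<open>Vector fields and the elasticity form\<close>

text \<open>The displacement spaces of both pairs have this form, which allows them to be treated
  alike.\<close>

definition vector_space_of :: "(real^'d \<Rightarrow> real) set \<Rightarrow> (real^'d \<Rightarrow> real^'d) set" where
  "vector_space_of F = {v. \<forall>i. (\<lambda>x. v x $ i) \<in> F}"

text \<open>Transposition preserves the Frobenius norm, so symmetrization does not increase it. The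
  trace bounds are Cauchy-Schwarz on the diagonal, and symmetrization leaves the trace
  unchanged.\<close>

lemma frobenius_bounds:
  fixes A :: "real^'d^'d"
  shows "((1/2) *\<^sub>R (A + transpose A)) \<bullet> ((1/2) *\<^sub>R (A + transpose A)) \<le> A \<bullet> A"
    and "(trace A)\<^sup>2 \<le> CARD('d) * (A \<bullet> A)"
    and "(trace A)\<^sup>2 \<le> CARD('d) * (((1/2) *\<^sub>R (A + transpose A)) \<bullet> ((1/2) *\<^sub>R (A + transpose A)))"
proof -
  have "transpose A \<bullet> transpose A = (\<Sum>i\<in>UNIV. \<Sum>j\<in>UNIV. A $ j $ i * A $ j $ i)"
    by (simp add: inner_vec_def transpose_def)
  also have "\<dots> = A \<bullet> A" by (subst sum.swap) (simp add: inner_vec_def)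
  finally have "norm (transpose A) = norm A" by (simp add: norm_eq_sqrt_inner)
  then have "norm ((1/2) *\<^sub>R (A + transpose A)) \<le> norm A"
    using norm_triangle_ineq[of A "transpose A"] by simp
  then show "((1/2) *\<^sub>R (A + transpose A)) \<bullet> ((1/2) *\<^sub>R (A + transpose A)) \<le> A \<bullet> A"
    by (simp only: norm_le)
  have tr: "(trace M)\<^sup>2 \<le> CARD('d) * (M \<bullet> M)" for M :: "real^'d^'d"
  proof -
    have "(trace M)\<^sup>2 \<le> (\<Sum>i\<in>UNIV. (M $ i $ i)\<^sup>2) * CARD('d)"
      unfolding trace_def using sum_squared_le_sum_of_squares[of "\<lambda>i. M $ i $ i" UNIV] by simp
    also have "(\<Sum>i\<in>UNIV. (M $ i $ i)\<^sup>2) \<le> (\<Sum>i\<in>UNIV. \<Sum>j\<in>UNIV. (M $ i $ j)\<^sup>2)"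
      by (rule sum_mono) (rule member_le_sum, auto)
    finally show ?thesis
      by (simp add: inner_vec_def power2_eq_square mult.commute mult_right_mono)
  qed
  show "(trace A)\<^sup>2 \<le> CARD('d) * (A \<bullet> A)" by (rule tr)
  have "trace ((1/2) *\<^sub>R (A + transpose A)) = trace A"
    by (simp add: trace_def transpose_def)
  with tr[of "(1/2) *\<^sub>R (A + transpose A)"]
  show "(trace A)\<^sup>2 \<le> CARD('d) * (((1/2) *\<^sub>R (A + transpose A)) \<bullet> ((1/2) *\<^sub>R (A + transpose A)))"
    by simp
qed

lemma L2_integrable_mat:
  fixes f :: "real^'d \<Rightarrow> real^'n^'m"
  assumes "\<And>i j. (\<lambda>x. f x $ i $ j) \<in> L2_space \<Omega>"
  shows "integrable (lebesgue_on \<Omega>) (\<lambda>x. f x \<bullet> f x)"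
  unfolding inner_vec_def inner_real_def
  using assms by (intro Bochner_Integration.integrable_sum L2_integrable_mult)

context conforming_space
begin

abbreviation "VF \<equiv> vector_space_of F"

lemma F_H1: "u \<in> F \<Longrightarrow> u \<in> H1_space \<Omega>"
  using F_H10 by (auto simp: H10_space_def)

lemma component: "v \<in> VF \<Longrightarrow> (\<lambda>x. v x $ i) \<in> F"
  by (simp add: vector_space_of_def)

lemma lin_space_VF: "lin_space VF"
proof -
  have "(\<lambda>_. 0) \<in> VF" using lin_space_zero[OF lin_space] by (simp add: vector_space_of_def)
  moreover have "(\<lambda>x. a *\<^sub>R u x + b *\<^sub>R v x) \<in> VF" if "u \<in> VF" "v \<in> VF" for u v a b
    using lin_spaceD[OF lin_space component[OF that(1)] component[OF that(2)], of a _ b]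
    by (simp add: vector_space_of_def)
  ultimately show ?thesis unfolding lin_space_def by blast
qed

lemma jacobian_component: "jacobian \<Omega> u x $ i $ j = weak_partial \<Omega> j (\<lambda>y. u y $ i) x"
  by (simp add: jacobian_def grad_def)

lemma jacobian_L2: "u \<in> VF \<Longrightarrow> (\<lambda>x. jacobian \<Omega> u x $ i $ j) \<in> L2_space \<Omega>"
  unfolding jacobian_component by (rule H1_spaceD(3)[OF F_H1[OF component]])

lemma jacobian_combine:
  assumes "u \<in> VF" "v \<in> VF"
  shows "AE x in lebesgue_on \<Omega>. jacobian \<Omega> (\<lambda>x. a *\<^sub>R u x + b *\<^sub>R v x) x
    = a *\<^sub>R jacobian \<Omega> u x + b *\<^sub>R jacobian \<Omega> v x"
proof -
  have "AE x in lebesgue_on \<Omega>. \<forall>i\<in>UNIV. \<forall>j\<in>UNIV. jacobian \<Omega> (\<lambda>x. a *\<^sub>R u x + b *\<^sub>R v x) x $ i $ j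
    = a * jacobian \<Omega> u x $ i $ j + b * jacobian \<Omega> v x $ i $ j"
    using weak_partial_combine[OF F_H1[OF component[OF assms(1)]] F_H1[OF component[OF assms(2)]]]
    by (intro AE_finite_allI finite) (simp add: jacobian_component)
  then show ?thesis by eventually_elim (simp add: vec_eq_iff)
qed

lemma strain_L2: "u \<in> VF \<Longrightarrow> (\<lambda>x. strain \<Omega> u x $ i $ j) \<in> L2_space \<Omega>"
  using L2_combine[OF jacobian_L2[of u i j] jacobian_L2[of u j i], of "1/2" "1/2"]
  by (simp add: strain_def transpose_def algebra_simps)

lemma strain_combine:
  assumes "u \<in> VF" "v \<in> VF"
  shows "AE x in lebesgue_on \<Omega>. strain \<Omega> (\<lambda>x. a *\<^sub>R u x + b *\<^sub>R v x) x $ i $ j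
    = a * strain \<Omega> u x $ i $ j + b * strain \<Omega> v x $ i $ j"
  using jacobian_combine[OF assms, of a b]
  by eventually_elim (simp add: strain_def transpose_def algebra_simps)

lemma divergence_L2: "u \<in> VF \<Longrightarrow> divergence \<Omega> u \<in> L2_space \<Omega>"
  unfolding divergence_def[abs_def] trace_def by (intro L2_sum jacobian_L2) auto

lemma divergence_combine:
  assumes "u \<in> VF" "v \<in> VF"
  shows "AE x in lebesgue_on \<Omega>. divergence \<Omega> (\<lambda>x. a *\<^sub>R u x + b *\<^sub>R v x) x
    = a * divergence \<Omega> u x + b * divergence \<Omega> v x"
  using jacobian_combine[OF assms, of a b]
  by eventually_elim (simp add: divergence_def trace_def sum.distrib sum_distrib_left)

lemma lin_on_divergence:
  "q \<in> L2_space \<Omega> \<Longrightarrow> lin_on VF (\<lambda>v. L2_inner \<Omega> (divergence \<Omega> v) q)"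
  by (rule lin_on_L2_inner_pullback[OF lin_space_VF divergence_L2 divergence_combine])

lemma semi_inner_strain: "semi_inner VF (\<lambda>u v. L2_inner \<Omega> (strain \<Omega> u) (strain \<Omega> v))"
proof (rule semi_inner_cong)
  show "semi_inner VF (\<lambda>u v. \<Sum>i\<in>UNIV. \<Sum>j\<in>UNIV.
      L2_inner \<Omega> (\<lambda>x. strain \<Omega> u x $ i $ j) (\<lambda>x. strain \<Omega> v x $ i $ j))"
    by (rule semi_inner_sum[OF finite semi_inner_sum[OF finite semi_inner_pullback[OF lin_space_VF
          strain_L2 strain_combine] lin_space_VF] lin_space_VF])
  show "(\<Sum>i\<in>UNIV. \<Sum>j\<in>UNIV. L2_inner \<Omega> (\<lambda>x. strain \<Omega> u x $ i $ j) (\<lambda>x. strain \<Omega> v x $ i $ j))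
      = L2_inner \<Omega> (strain \<Omega> u) (strain \<Omega> v)" if "u \<in> VF" "v \<in> VF" for u v
    by (rule L2_inner_mat[OF strain_L2[OF that(1)] strain_L2[OF that(2)], symmetric])
qed

lemma semi_inner_divergence: "semi_inner VF (\<lambda>u v. L2_inner \<Omega> (divergence \<Omega> u) (divergence \<Omega> v))"
  by (rule semi_inner_pullback[OF lin_space_VF divergence_L2 divergence_combine])

lemma semi_inner_a_form:
  assumes "lam \<ge> 0" "\<mu> \<ge> 0"
  shows "semi_inner VF (a_form \<Omega> lam \<mu>)"
  using semi_inner_combine[OF semi_inner_strain semi_inner_divergence, of "2 * \<mu>" lam] assms
  by (simp add: a_form_def[abs_def])

lemma a_form_definite:
  assumes "lam \<ge> 0" "\<mu> > 0" "u \<in> VF" "a_form \<Omega> lam \<mu> u u = 0"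
  shows "u = (\<lambda>_. 0)"
proof -
  have "2 * \<mu> * L2_inner \<Omega> (strain \<Omega> u) (strain \<Omega> u) = 0"
    using assms(1,2,4) L2_inner_nonneg[of \<Omega> "strain \<Omega> u"] L2_inner_nonneg[of \<Omega> "divergence \<Omega> u"]
    by (simp add: a_form_def add_nonneg_eq_0_iff)
  then have "(\<Sum>i\<in>UNIV. \<Sum>j\<in>UNIV. L2_inner \<Omega> (\<lambda>x. strain \<Omega> u x $ i $ j) (\<lambda>x. strain \<Omega> u x $ i $ j)) = 0"
    using assms(2) by (simp add: L2_inner_mat[OF strain_L2[OF assms(3)] strain_L2[OF assms(3)]])
  then have z: "L2_inner \<Omega> (\<lambda>x. strain \<Omega> u x $ i $ i) (\<lambda>x. strain \<Omega> u x $ i $ i) = 0" for i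
    by (simp add: sum_nonneg_eq_0_iff sum_nonneg L2_inner_nonneg)
  have "(\<lambda>x. u x $ i) = (\<lambda>_. 0)" for i
  proof (rule definite[OF component[OF assms(3)]])
    have "AE x in lebesgue_on \<Omega>. strain \<Omega> u x $ i $ i = 0"
      by (rule L2_inner_self_eq_0_AE[OF strain_L2[OF assms(3)] z])
    then have "AE x in lebesgue_on \<Omega>. weak_partial \<Omega> i (\<lambda>y. u y $ i) x = 0"
      by eventually_elim (simp add: strain_def transpose_def jacobian_component)
    then show "L2_inner \<Omega> (\<lambda>x. u x $ i) (\<lambda>x. u x $ i) = 0"
      using F_H10 component[OF assms(3)] by (intro H10_eq_0_if_weak_partial_eq_0) auto
  qed
  then have "u x $ i = 0" for x i by (metis (full_types))
  then show ?thesis by (auto simp: vec_eq_iff)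
qed

section \<open>Bounds between divergence, strain, Jacobian and elasticity form\<close>

lemma divergence_le_strain:
  assumes "v \<in> VF"
  shows "L2_inner \<Omega> (divergence \<Omega> v) (divergence \<Omega> v)
    \<le> CARD('d) * L2_inner \<Omega> (strain \<Omega> v) (strain \<Omega> v)"
proof -
  have "(\<integral>x. divergence \<Omega> v x \<bullet> divergence \<Omega> v x \<partial>lebesgue_on \<Omega>)
      \<le> (\<integral>x. CARD('d) * (strain \<Omega> v x \<bullet> strain \<Omega> v x) \<partial>lebesgue_on \<Omega>)"
  proof (rule integral_mono)
    show "divergence \<Omega> v x \<bullet> divergence \<Omega> v x \<le> CARD('d) * (strain \<Omega> v x \<bullet> strain \<Omega> v x)" for x
      using frobenius_bounds(3)[of "jacobian \<Omega> v x"]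
      by (simp only: divergence_def strain_def inner_real_def power2_eq_square)
  qed (use L2_integrable_mult[OF divergence_L2 divergence_L2] assms
        L2_integrable_mat[OF strain_L2] in \<open>auto intro!: integrable_mult_right\<close>)
  then show ?thesis by (simp add: L2_inner_def)
qed

lemma divergence_le_jacobian:
  assumes "v \<in> VF"
  shows "L2_inner \<Omega> (divergence \<Omega> v) (divergence \<Omega> v)
    \<le> CARD('d) * L2_inner \<Omega> (jacobian \<Omega> v) (jacobian \<Omega> v)"
proof -
  have "(\<integral>x. divergence \<Omega> v x \<bullet> divergence \<Omega> v x \<partial>lebesgue_on \<Omega>)
      \<le> (\<integral>x. CARD('d) * (jacobian \<Omega> v x \<bullet> jacobian \<Omega> v x) \<partial>lebesgue_on \<Omega>)"
  proof (rule integral_mono)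
    show "divergence \<Omega> v x \<bullet> divergence \<Omega> v x \<le> CARD('d) * (jacobian \<Omega> v x \<bullet> jacobian \<Omega> v x)" for x
      using frobenius_bounds(2)[of "jacobian \<Omega> v x"]
      by (simp only: divergence_def inner_real_def power2_eq_square)
  qed (use L2_integrable_mult[OF divergence_L2 divergence_L2] assms
        L2_integrable_mat[OF jacobian_L2] in \<open>auto intro!: integrable_mult_right\<close>)
  then show ?thesis by (simp add: L2_inner_def)
qed

lemma strain_le_jacobian:
  assumes "v \<in> VF"
  shows "L2_inner \<Omega> (strain \<Omega> v) (strain \<Omega> v) \<le> L2_inner \<Omega> (jacobian \<Omega> v) (jacobian \<Omega> v)"
  unfolding L2_inner_def
proof (rule integral_mono)
  show "strain \<Omega> v x \<bullet> strain \<Omega> v x \<le> jacobian \<Omega> v x \<bullet> jacobian \<Omega> v x" for x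
    using frobenius_bounds(1)[of "jacobian \<Omega> v x"] by (simp only: strain_def)
qed (use L2_integrable_mat[OF strain_L2[OF assms]] L2_integrable_mat[OF jacobian_L2[OF assms]] in auto)

text \<open>This explains \<open>\<zeta>\<close>: the trace bound lets the strain part contribute
  \<open>2 * \<mu> / d\<close> in addition to the explicit \<open>lam\<close>.\<close>

lemma divergence_le_a_form:
  assumes "\<mu> \<ge> 0" "v \<in> VF"
  shows "(lam + 2 * \<mu> / CARD('d)) * L2_inner \<Omega> (divergence \<Omega> v) (divergence \<Omega> v) \<le> a_form \<Omega> lam \<mu> v v"
proof -
  have "2 * \<mu> / CARD('d) * L2_inner \<Omega> (divergence \<Omega> v) (divergence \<Omega> v)
      \<le> 2 * \<mu> / CARD('d) * (CARD('d) * L2_inner \<Omega> (strain \<Omega> v) (strain \<Omega> v))"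
    using assms divergence_le_strain by (intro mult_left_mono) auto
  also have "\<dots> = 2 * \<mu> * L2_inner \<Omega> (strain \<Omega> v) (strain \<Omega> v)" by simp
  finally show ?thesis by (simp add: a_form_def algebra_simps)
qed

text \<open>The Jacobian bounds the strain with factor 1 and the divergence with factor
  \<open>d\<close>, and \<open>2 * \<mu> + d * lam\<close> is \<open>d\<close> times the squared
  \<open>\<zeta>\<close>. The constant is independent of the domain.\<close>

lemma a_form_le_H1:
  assumes "lam \<ge> 0" "\<mu> \<ge> 0" "v \<in> VF"
  shows "a_form \<Omega> lam \<mu> v v \<le> CARD('d) * (lam + 2 * \<mu> / CARD('d)) * (H1_norm_vec \<Omega> v)\<^sup>2"
proof -
  let ?J = "L2_inner \<Omega> (jacobian \<Omega> v) (jacobian \<Omega> v)"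
  have J: "?J \<le> (H1_norm_vec \<Omega> v)\<^sup>2"
    by (simp add: H1_norm_vec_def L2_norm_power2 L2_inner_nonneg)
  have "a_form \<Omega> lam \<mu> v v \<le> 2 * \<mu> * ?J + lam * (CARD('d) * ?J)"
    unfolding a_form_def using assms strain_le_jacobian divergence_le_jacobian
    by (intro add_mono mult_left_mono) auto
  also have "\<dots> = CARD('d) * (lam + 2 * \<mu> / CARD('d)) * ?J" by (simp add: algebra_simps)
  also have "\<dots> \<le> CARD('d) * (lam + 2 * \<mu> / CARD('d)) * (H1_norm_vec \<Omega> v)\<^sup>2"
    using J assms by (intro mult_left_mono) auto
  finally show ?thesis .
qed

lemma separating_functionals:
  "\<exists>L. finite L \<and> (\<forall>l\<in>L. lin_on F l) \<and> (\<forall>u\<in>F. (\<forall>l\<in>L. l u = 0) \<longrightarrow> u = (\<lambda>_. 0))"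
proof -
  obtain X where "finite X" "\<forall>u\<in>F. (\<forall>x\<in>X. u x = 0) \<longrightarrow> u = (\<lambda>_. 0)" using separating by blast
  then show ?thesis
    by (intro exI[of _ "(\<lambda>x u. u x) ` X"]) (auto simp: lin_on_def)
qed

lemma separating_functionals_VF:
  "\<exists>L. finite L \<and> (\<forall>l\<in>L. lin_on VF l) \<and> (\<forall>u\<in>VF. (\<forall>l\<in>L. l u = 0) \<longrightarrow> u = (\<lambda>_. 0))"
proof -
  obtain X where X: "finite X" "\<And>u. u \<in> F \<Longrightarrow> (\<forall>x\<in>X. u x = 0) \<Longrightarrow> u = (\<lambda>_. 0)"
    using separating by blast
  let ?L = "(\<lambda>(x, i) u. u x $ i) ` (X \<times> (UNIV :: 'd set))"
  have "u = (\<lambda>_. 0)" if u: "u \<in> VF" and z: "\<forall>l\<in>?L. l u = 0" for u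
  proof -
    have "(\<lambda>x. u x $ i) = (\<lambda>_. 0)" for i
      using z by (intro X(2)[OF component[OF u]]) auto
    then have "u x $ i = 0" for x i by (metis (full_types))
    then show ?thesis by (auto simp: vec_eq_iff)
  qed
  moreover have "finite ?L" using X(1) by simp
  moreover have "\<forall>l\<in>?L. lin_on VF l" by (auto simp: lin_on_def)
  ultimately show ?thesis by blast
qed

end

section \<open>Block operators\<close>

lemma dual_space_iff: "f \<in> dual_space W \<longleftrightarrow> f \<in> extensional W \<and> lin_on W f"
  by (auto simp: dual_space_def lin_on_def)

lemma restrict_mem_dual_space:
  "lin_space W \<Longrightarrow> lin_on W f \<Longrightarrow> restrict f W \<in> dual_space W"
  by (auto simp: dual_space_iff lin_on_def lin_spaceD)

lemma restrict_eq_extensional: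
  "f \<in> extensional W \<Longrightarrow> (\<And>v. v \<in> W \<Longrightarrow> g v = f v) \<Longrightarrow> restrict g W = f"
  by (auto simp: fun_eq_iff restrict_def extensional_def)

lemma definite_form_cancel:
  assumes "semi_inner W c" "\<And>u. u \<in> W \<Longrightarrow> c u u = 0 \<Longrightarrow> u = (\<lambda>_. 0)"
    and "u \<in> W" "v \<in> W" "\<And>w. w \<in> W \<Longrightarrow> c u w = c v w"
  shows "u = v"
proof -
  interpret semi_inner W c by fact
  have d: "(\<lambda>x. u x - v x) \<in> W" by (rule lin_space_diff[OF space assms(3,4)])
  have "c (\<lambda>x. u x - v x) (\<lambda>x. u x - v x) = 0"
    using lin_on_diff[OF lin[OF d] assms(3,4)] assms(5)[OF d] by simp
  from fun_cong[OF assms(2)[OF d this]] have "u x - v x = 0" for x .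
  then show ?thesis by (simp add: fun_eq_iff)
qed

text \<open>Turns operator inverses into variational equations. For \<open>L\<close> surjectivity
  suffices, since any chosen preimage satisfies the two equations; for \<open>D\<close> a bijection
  onto the dual is needed, because \<open>inner_inv\<close> has to recover \<open>D\<close> from its
  inverse.\<close>

lemma block_operators:
  fixes V :: "(real^'d \<Rightarrow> real^'d) set" and Q :: "(real^'d \<Rightarrow> real) set"
    and D L A :: "'d pair \<Rightarrow> 'd dual_pair"
  assumes a: "semi_inner V a" "\<And>u. u \<in> V \<Longrightarrow> a u u = 0 \<Longrightarrow> u = (\<lambda>_. 0)"
    and c: "semi_inner Q c0" "\<And>u. u \<in> Q \<Longrightarrow> c0 u u = 0 \<Longrightarrow> u = (\<lambda>_. 0)"
    and c1: "semi_inner Q c1"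
    and LV: "\<exists>L. finite L \<and> (\<forall>l\<in>L. lin_on V l) \<and> (\<forall>u\<in>V. (\<forall>l\<in>L. l u = 0) \<longrightarrow> u = (\<lambda>_. 0))"
    and LQ: "\<exists>L. finite L \<and> (\<forall>l\<in>L. lin_on Q l) \<and> (\<forall>u\<in>Q. (\<forall>l\<in>L. l u = 0) \<longrightarrow> u = (\<lambda>_. 0))"
    and b: "\<And>q. q \<in> Q \<Longrightarrow> lin_on V (\<lambda>v. b v q)" "\<And>v. v \<in> V \<Longrightarrow> lin_on Q (b v)"
    and D: "\<And>u p. u \<in> V \<Longrightarrow> p \<in> Q \<Longrightarrow> D (u, p) = (\<lambda>v\<in>V. a u v, \<lambda>q\<in>Q. c0 p q)"
    and L: "\<And>u p. u \<in> V \<Longrightarrow> p \<in> Q \<Longrightarrow> L (u, p) = (\<lambda>v\<in>V. a u v, \<lambda>q\<in>Q. \<alpha> * b u q + c0 p q)"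
    and A: "\<And>u p. u \<in> V \<Longrightarrow> p \<in> Q \<Longrightarrow>
       A (u, p) = (\<lambda>v\<in>V. a u v - \<alpha> * b v p, \<lambda>q\<in>Q. \<alpha> * b u q + c1 p q)"
    and x: "u \<in> V" "p \<in> Q"
  obtains w r where "w \<in> V" "r \<in> Q" "inv_into (V \<times> Q) L (A (u, p)) = (w, r)"
    "\<And>v. v \<in> V \<Longrightarrow> a w v = a u v - \<alpha> * b v p"
    "\<And>q. q \<in> Q \<Longrightarrow> \<alpha> * b w q + c0 r q = \<alpha> * b u q + c1 p q"
    "\<And>u p v q. u \<in> V \<Longrightarrow> p \<in> Q \<Longrightarrow> v \<in> V \<Longrightarrow> q \<in> Q \<Longrightarrow>
       inner_inv V Q (inv_into (V \<times> Q) D) (u, p) (v, q) = a u v + c0 p q"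
proof -
  interpret a: semi_inner V a by fact
  interpret c0: semi_inner Q c0 by fact
  interpret c1: semi_inner Q c1 by fact
  have rieszV: "\<exists>u\<in>V. \<forall>v\<in>V. a u v = f v" if "lin_on V f" for f
  proof -
    obtain LL where "finite LL" "\<And>l. l \<in> LL \<Longrightarrow> lin_on V l"
      "\<And>u. u \<in> V \<Longrightarrow> (\<And>l. l \<in> LL \<Longrightarrow> l u = 0) \<Longrightarrow> u = (\<lambda>_. 0)" using LV by metis
    from riesz_representation[OF this(1) a this(2,3) that] show ?thesis .
  qed
  have rieszQ: "\<exists>u\<in>Q. \<forall>v\<in>Q. c0 u v = f v" if "lin_on Q f" for f
  proof -
    obtain LL where "finite LL" "\<And>l. l \<in> LL \<Longrightarrow> lin_on Q l"
      "\<And>u. u \<in> Q \<Longrightarrow> (\<And>l. l \<in> LL \<Longrightarrow> l u = 0) \<Longrightarrow> u = (\<lambda>_. 0)" using LQ by metis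
    from riesz_representation[OF this(1) c this(2,3) that] show ?thesis .
  qed
  have surjL: "(f, g) \<in> L ` (V \<times> Q)" if f: "f \<in> dual_space V" and g: "g \<in> dual_space Q" for f g
  proof -
    have fl: "lin_on V f" "f \<in> extensional V" and gl: "lin_on Q g" "g \<in> extensional Q"
      using f g by (auto simp: dual_space_iff)
    obtain w where w: "w \<in> V" "\<And>v. v \<in> V \<Longrightarrow> a w v = f v" using rieszV[OF fl(1)] by blast
    \<comment> \<open>Forward substitution: \<open>w\<close> is already known, so its coupling term
      moves to the right-hand side.\<close>
    obtain r where r: "r \<in> Q" "\<And>q. q \<in> Q \<Longrightarrow> c0 r q = 1 * g q + (- \<alpha>) * b w q"
      using rieszQ[OF lin_on_combine[OF gl(1) b(2)[OF w(1)], of 1 "- \<alpha>"]] by blast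
    have "(\<lambda>v\<in>V. a w v) = f" "(\<lambda>q\<in>Q. \<alpha> * b w q + c0 r q) = g"
      using w(2) r(2) fl(2) gl(2) by (simp_all add: restrict_eq_extensional)
    then have "L (w, r) = (f, g)" using L[OF w(1) r(1)] by simp
    then show ?thesis using w(1) r(1) by (metis SigmaI image_eqI)
  qed
  have injD: "inj_on D (V \<times> Q)"
  proof (rule inj_onI, clarify)
    fix u p v q assume m: "u \<in> V" "p \<in> Q" "v \<in> V" "q \<in> Q" and eq: "D (u, p) = D (v, q)"
    have eqs: "restrict (a u) V = restrict (a v) V" "restrict (c0 p) Q = restrict (c0 q) Q"
      using eq D m by simp_all
    have "a u w = a v w" if "w \<in> V" for w
      using fun_cong[OF eqs(1), of w] that by simp
    then have "u = v" using definite_form_cancel[OF a m(1,3)] by blast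
    moreover have "c0 p w = c0 q w" if "w \<in> Q" for w
      using fun_cong[OF eqs(2), of w] that by simp
    then have "p = q" using definite_form_cancel[OF c m(2,4)] by blast
    ultimately show "u = v \<and> p = q" by simp
  qed
  have Ddual: "D (u, p) \<in> dual_prod V Q" if "u \<in> V" "p \<in> Q" for u p
    unfolding D[OF that] dual_prod_def
    using restrict_mem_dual_space[OF a.space a.lin'[OF that(1)]]
      restrict_mem_dual_space[OF c0.space c0.lin'[OF that(2)]] by simp
  have surjD: "y \<in> D ` (V \<times> Q)" if y: "y \<in> dual_prod V Q" for y
  proof -
    obtain f g where fg: "y = (f, g)" "f \<in> dual_space V" "g \<in> dual_space Q"
      using y by (auto simp: dual_prod_def)
    have fl: "lin_on V f" "f \<in> extensional V" and gl: "lin_on Q g" "g \<in> extensional Q"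
      using fg by (auto simp: dual_space_iff)
    obtain w where w: "w \<in> V" "\<And>v. v \<in> V \<Longrightarrow> a w v = f v" using rieszV[OF fl(1)] by blast
    obtain r where r: "r \<in> Q" "\<And>q. q \<in> Q \<Longrightarrow> c0 r q = g q" using rieszQ[OF gl(1)] by blast
    have "(\<lambda>v\<in>V. a w v) = f" "(\<lambda>q\<in>Q. c0 r q) = g"
      using w(2) r(2) fl(2) gl(2) by (simp_all add: restrict_eq_extensional)
    then have "D (w, r) = y" using D[OF w(1) r(1)] fg(1) by simp
    then show ?thesis using w(1) r(1) by (metis SigmaI image_eqI)
  qed
  have inner: "inner_inv V Q (inv_into (V \<times> Q) D) (u, p) (v, q) = a u v + c0 p q"
    if m: "u \<in> V" "p \<in> Q" "v \<in> V" "q \<in> Q" for u p v q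
  proof -
    \<comment> \<open>The outer inverse picks a dual element whose image under the inner inverse is
      \<open>(u, p)\<close>. Injectivity on the dual identifies it as
      \<open>D (u, p)\<close>.\<close>
    have "inj_on (inv_into (V \<times> Q) D) (dual_prod V Q)"
      using surjD by (intro inj_on_inv_into) blast
    moreover have "inv_into (V \<times> Q) D (D (u, p)) = (u, p)"
      by (rule inv_into_f_f[OF injD]) (use m in simp)
    ultimately have "inv_into (dual_prod V Q) (inv_into (V \<times> Q) D) (u, p) = D (u, p)"
      using inv_into_f_f[OF _ Ddual[OF m(1,2)]] by metis
    then show ?thesis using D m by (simp add: inner_inv_def)
  qed
  define y where "y = inv_into (V \<times> Q) L (A (u, p))"
  have "lin_on V (\<lambda>v. 1 * a u v + (- \<alpha>) * b v p)"
    by (rule lin_on_combine[OF a.lin'[OF x(1)] b(1)[OF x(2)]])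
  from restrict_mem_dual_space[OF a.space this]
  have 1: "(\<lambda>v\<in>V. a u v - \<alpha> * b v p) \<in> dual_space V" by simp
  have "lin_on Q (\<lambda>q. \<alpha> * b u q + 1 * c1 p q)"
    by (rule lin_on_combine[OF b(2)[OF x(1)] c1.lin'[OF x(2)]])
  from restrict_mem_dual_space[OF c1.space this]
  have 2: "(\<lambda>q\<in>Q. \<alpha> * b u q + c1 p q) \<in> dual_space Q" by simp
  have im: "A (u, p) \<in> L ` (V \<times> Q)" unfolding A[OF x] by (rule surjL[OF 1 2])
  obtain w r where wr: "y = (w, r)" by (cases y)
  have m: "w \<in> V" "r \<in> Q" using inv_into_into[OF im] wr by (auto simp: y_def)
  have "L (w, r) = A (u, p)" using f_inv_into_f[OF im] wr by (simp add: y_def)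
  then have e: "(\<lambda>v\<in>V. a w v) = (\<lambda>v\<in>V. a u v - \<alpha> * b v p)"
    "(\<lambda>q\<in>Q. \<alpha> * b w q + c0 r q) = (\<lambda>q\<in>Q. \<alpha> * b u q + c1 p q)"
    unfolding L[OF m] A[OF x] by auto
  show thesis
  proof (rule that[OF m _ _ _ inner])
    show "inv_into (V \<times> Q) L (A (u, p)) = (w, r)" using wr by (simp add: y_def)
    show "a w v = a u v - \<alpha> * b v p" if "v \<in> V" for v using fun_cong[OF e(1), of v] that by simp
    show "\<alpha> * b w q + c0 r q = \<alpha> * b u q + c1 p q" if "q \<in> Q" for q
      using fun_cong[OF e(2), of q] that by simp
  qed
qed

text \<open>\<open>M\<close> bounds the dual norm of the functional given by \<open>p\<close>, hence
  the supremum. Rearranged, the stabilizing gradient term appears on the right.\<close>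

lemma weak_inf_sup_bound:
  assumes inf_sup: "weak_inf_sup \<Omega> V Q h \<gamma> \<xi>" and p: "p \<in> Q"
    and "M \<ge> 0" and M: "\<And>v. v \<in> V \<Longrightarrow> L2_inner \<Omega> (divergence \<Omega> v) p \<le> M * H1_norm_vec \<Omega> v"
  shows "\<gamma> * L2_norm \<Omega> p \<le> M + \<xi> * h * L2_norm \<Omega> (grad \<Omega> p)"
proof -
  have "H1_norm_vec \<Omega> v \<ge> 0" for v by (simp add: H1_norm_vec_def)
  \<comment> \<open>If the norm of \<open>v\<close> is 0, the quotient is 0 by convention; there the
    bound rests on \<open>M \<ge> 0\<close>.\<close>
  then have "L2_inner \<Omega> (divergence \<Omega> v) p / H1_norm_vec \<Omega> v \<le> M" if "v \<in> V" for v
    using M[OF that] \<open>M \<ge> 0\<close>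
    by (cases "H1_norm_vec \<Omega> v = 0") (auto simp: divide_le_eq less_le)
  then have "(SUP v\<in>V - {\<lambda>x. 0}. ereal (L2_inner \<Omega> (divergence \<Omega> v) p / H1_norm_vec \<Omega> v)) \<le> ereal M"
    by (intro SUP_least) auto
  then have "ereal (\<gamma> * L2_norm \<Omega> p - \<xi> * h * L2_norm \<Omega> (grad \<Omega> p)) \<le> ereal M"
    using inf_sup p order_trans unfolding weak_inf_sup_def by blast
  then show ?thesis by simp
qed

text \<open>The abstract factor \<open>2 + X + 2 * Y\<close> with
  \<open>X = 2 * \<xi>\<^sup>2 / (\<gamma>\<^sup>2 * \<delta>)\<close> and
  \<open>Y = 2 * d / \<gamma>\<^sup>2\<close>: the 2 comes from squaring a sum,
  \<open>\<gamma>\<close> and \<open>\<xi>\<close> from inf-sup, \<open>\<delta>\<close> from the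
  stabilization, and \<open>d\<close> from comparing \<open>a\<close> with the \<open>H1\<close>
  norm.\<close>

lemma (in bounded_domain) biot_preconditioner_bounds:
  assumes V: "conforming_space \<Omega> F" "V = vector_space_of F" and Q: "conforming_space \<Omega> Q"
    and inf_sup: "weak_inf_sup \<Omega> V Q h \<gamma> \<xi>"
    and pos: "\<gamma> > 0" "\<delta> > 0" "lam \<ge> 0" "\<mu> > 0" "\<alpha> > 0" "K > 0" "h > 0" "\<tau> > 0"
    and \<zeta>: "\<zeta> = sqrt (lam + 2 * \<mu> / real CARD('d))"
    and s: "s = \<alpha>\<^sup>2 / \<zeta>\<^sup>2" and \<eta>: "\<eta> = \<delta> * s"
    and A: "A = biot_op \<Omega> V Q lam \<mu> \<alpha> K h \<tau> \<eta>"
    and BL: "BL = inv_into (V \<times> Q) (lower_op \<Omega> V Q lam \<mu> \<alpha> K h \<tau> \<eta> s)"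
    and BD: "BD = inv_into (V \<times> Q) (diag_op \<Omega> V Q lam \<mu> K h \<tau> \<eta> s)"
    and x: "x \<in> V \<times> Q" "x \<noteq> (\<lambda>_. 0, \<lambda>_. 0)"
  shows "inner_inv V Q BD x x > 0"
    and "inner_inv V Q BD x x \<le> (2 + 2 * \<xi>\<^sup>2 / (\<gamma>\<^sup>2 * \<delta>) + 2 * (2 * CARD('d) / \<gamma>\<^sup>2)) * inner_inv V Q BD (BL (A x)) x"
    and "inner_inv V Q BD (BL (A x)) (BL (A x)) \<le> 4 * inner_inv V Q BD x x"
proof -
  interpret F: conforming_space \<Omega> F by fact
  interpret Q: conforming_space \<Omega> Q by fact
  interpret L2: semi_inner "L2_space \<Omega>" "L2_inner \<Omega>" by (rule semi_inner_L2)
  interpret H1grad: semi_inner "H1_space \<Omega>" "\<lambda>u v. L2_inner \<Omega> (grad \<Omega> u) (grad \<Omega> v)"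
    by (rule semi_inner_grad)
  define a where "a = a_form \<Omega> lam \<mu>"
  define b where "b = (\<lambda>v q. L2_inner \<Omega> (divergence \<Omega> v) q)"
  define m :: "(real^'d \<Rightarrow> real) \<Rightarrow> (real^'d \<Rightarrow> real) \<Rightarrow> real" where "m = L2_inner \<Omega>"
  define g where "g = (\<lambda>p q. L2_inner \<Omega> (grad \<Omega> p) (grad \<Omega> q))"
  define c1 where "c1 = (\<lambda>p q. \<tau> * K * g p q + \<eta> * h\<^sup>2 * g p q)"
  define c0 where "c0 = (\<lambda>p q. c1 p q + s * m p q)"
  have z2: "\<zeta>\<^sup>2 = lam + 2 * \<mu> / CARD('d)" "lam + 2 * \<mu> / CARD('d) > 0"
    using pos by (simp_all add: \<zeta> add_nonneg_pos)
  then have "s > 0" "\<eta> > 0" using pos by (simp_all add: s \<eta>)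
  have QL2: "q \<in> L2_space \<Omega>" if "q \<in> Q" for q using H1_spaceD(1)[OF Q.F_H1[OF that]] .
  have VL2: "divergence \<Omega> v \<in> L2_space \<Omega>" if "v \<in> V" for v using F.divergence_L2 that V(2) by simp
  have sa: "semi_inner V a" unfolding a_def V(2) using F.semi_inner_a_form pos by simp
  have da: "u = (\<lambda>_. 0)" if "u \<in> V" "a u u = 0" for u
    using F.a_form_definite[of lam \<mu> u] that pos unfolding a_def V(2) by simp
  have sm: "semi_inner Q m"
    unfolding m_def by (rule L2.semi_inner_subspace[OF Q.lin_space]) (use QL2 in blast)
  have sg: "semi_inner Q g"
    unfolding g_def by (rule H1grad.semi_inner_subspace[OF Q.lin_space]) (use Q.F_H1 in blast)
  have sc1: "semi_inner Q c1"
    unfolding c1_def by (rule semi_inner_combine[OF sg sg]) (use pos \<open>\<eta> > 0\<close> in simp_all)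
  have sc0: "semi_inner Q c0"
    using semi_inner_combine[OF sc1 sm, of 1 s] \<open>s > 0\<close> by (simp add: c0_def)
  interpret a: semi_inner V a by (rule sa)
  interpret m: semi_inner Q m by (rule sm)
  interpret g: semi_inner Q g by (rule sg)
  interpret c1: semi_inner Q c1 by (rule sc1)
  interpret c0: semi_inner Q c0 by (rule sc0)
  have dc0: "q = (\<lambda>_. 0)" if q: "q \<in> Q" "c0 q q = 0" for q
  proof -
    have "s * m q q = 0"
      using q(2) c1.nonneg[OF q(1)] mult_nonneg_nonneg[OF less_imp_le[OF \<open>s > 0\<close>] m.nonneg[OF q(1)]]
      by (simp add: c0_def add_nonneg_eq_0_iff)
    then show ?thesis using Q.definite[OF q(1)] \<open>s > 0\<close> by (simp add: m_def)
  qed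
  have b1: "lin_on V (\<lambda>v. b v q)" if "q \<in> Q" for q
    unfolding b_def V(2) by (rule F.lin_on_divergence[OF QL2[OF that]])
  have b2: "lin_on Q (b v)" if "v \<in> V" for v
    using L2.lin'[OF VL2[OF that]] QL2 unfolding lin_on_def b_def by blast
  obtain u p where up: "x = (u, p)" "u \<in> V" "p \<in> Q" using x(1) by blast
  have D_eq: "diag_op \<Omega> V Q lam \<mu> K h \<tau> \<eta> s (u, p) = (\<lambda>v\<in>V. a u v, \<lambda>q\<in>Q. c0 p q)"
    if "u \<in> V" "p \<in> Q" for u p
    by (auto simp: op_Au_def op_Ap_def op_Lp_def op_M_def ap_form_def a_def c0_def c1_def g_def m_def
        L2_inner_def algebra_simps intro!: restrict_ext)
  have L_eq: "lower_op \<Omega> V Q lam \<mu> \<alpha> K h \<tau> \<eta> s (u, p) = (\<lambda>v\<in>V. a u v, \<lambda>q\<in>Q. \<alpha> * b u q + c0 p q)"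
    if "u \<in> V" "p \<in> Q" for u p
    by (auto simp: op_Au_def op_Ap_def op_Lp_def op_M_def op_B_def ap_form_def a_def b_def c0_def c1_def
        g_def m_def L2_inner_def algebra_simps intro!: restrict_ext)
  have A_eq: "A (u, p) = (\<lambda>v\<in>V. a u v - \<alpha> * b v p, \<lambda>q\<in>Q. \<alpha> * b u q + c1 p q)"
    if "u \<in> V" "p \<in> Q" for u p
    using that by (auto simp: A op_Au_def op_Ap_def op_Lp_def op_B_def op_BT_def ap_form_def a_def b_def
        c1_def g_def L2_inner_def algebra_simps intro!: restrict_ext)
  obtain w r where wr: "w \<in> V" "r \<in> Q" "BL (A (u, p)) = (w, r)"
    and eq1: "\<And>v. v \<in> V \<Longrightarrow> a w v = a u v - \<alpha> * b v p"
    and eq2: "\<And>q. q \<in> Q \<Longrightarrow> \<alpha> * b w q + c0 r q = \<alpha> * b u q + c1 p q"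
    and inner: "\<And>u p v q. u \<in> V \<Longrightarrow> p \<in> Q \<Longrightarrow> v \<in> V \<Longrightarrow> q \<in> Q \<Longrightarrow>
       inner_inv V Q BD (u, p) (v, q) = a u v + c0 p q"
    unfolding BL BD
    using block_operators[OF sa da sc0 dc0 sc1 F.separating_functionals_VF[folded V(2)]
        Q.separating_functionals b1 b2 D_eq L_eq A_eq up(2,3)] by blast
  have div_le: "\<zeta>\<^sup>2 * L2_inner \<Omega> (divergence \<Omega> v) (divergence \<Omega> v) \<le> a v v" if "v \<in> V" for v
    unfolding z2(1) a_def using F.divergence_le_a_form that pos V(2) by simp
  \<comment> \<open>The weight is made for this:
    \<open>\<alpha>\<^sup>2 = s * \<zeta>\<^sup>2\<close>, and \<open>\<zeta>\<close> is consumed by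
    the divergence bound, leaving the constant 1.\<close>
  have cont: "(\<alpha> * b v q)\<^sup>2 \<le> a v v * (s * m q q)" if v: "v \<in> V" and q: "q \<in> Q" for v q
  proof -
    have "(b v q)\<^sup>2 \<le> L2_inner \<Omega> (divergence \<Omega> v) (divergence \<Omega> v) * m q q"
      unfolding b_def m_def by (rule L2.cauchy_schwarz[OF VL2[OF v] QL2[OF q]])
    then have "\<zeta>\<^sup>2 * (b v q)\<^sup>2 \<le> (\<zeta>\<^sup>2 * L2_inner \<Omega> (divergence \<Omega> v) (divergence \<Omega> v)) * m q q"
      using mult_left_mono[of "(b v q)\<^sup>2" _ "\<zeta>\<^sup>2"] by (simp add: mult.assoc)
    also have "\<dots> \<le> a v v * m q q"
      by (rule mult_right_mono[OF div_le[OF v] m.nonneg[OF q]])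
    finally have "s * (\<zeta>\<^sup>2 * (b v q)\<^sup>2) \<le> s * (a v v * m q q)"
      using \<open>s > 0\<close> by (intro mult_left_mono) auto
    moreover have s\<zeta>: "\<alpha>\<^sup>2 = s * \<zeta>\<^sup>2" using z2 by (simp add: s)
    ultimately show ?thesis unfolding power_mult_distrib s\<zeta> by (simp add: mult_ac)
  qed
  have bound: "s * m p p \<le> 2 * \<xi>\<^sup>2 / (\<gamma>\<^sup>2 * \<delta>) * c1 p p + 2 * CARD('d) / \<gamma>\<^sup>2 * a e e"
    if e: "e \<in> V" and p: "p \<in> Q" and ep: "\<And>v. v \<in> V \<Longrightarrow> a e v = - \<alpha> * b v p" for e p
  proof -
    \<comment> \<open>Cauchy-Schwarz in \<open>a\<close> bounds
      \<open>(\<alpha> * b v p)\<^sup>2\<close> by \<open>a e e\<close> times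
      \<open>d * \<zeta>\<^sup>2\<close> times the squared norm of \<open>v\<close>; dividing by
      \<open>\<alpha>\<^sup>2 = s * \<zeta>\<^sup>2\<close> leaves \<open>M\<^sup>2\<close>.\<close>
    define M where "M = sqrt (CARD('d) * a e e / s)"
    have aee: "a e e \<ge> 0" by (rule a.nonneg[OF e])
    have "M \<ge> 0" using aee \<open>s > 0\<close> by (simp add: M_def)
    have M2: "s * M\<^sup>2 = CARD('d) * a e e" using aee \<open>s > 0\<close> by (simp add: M_def)
    have "b v p \<le> M * H1_norm_vec \<Omega> v" if v: "v \<in> V" for v
    proof (rule power2_le_imp_le)
      have "\<alpha>\<^sup>2 * (b v p)\<^sup>2 = (a e v)\<^sup>2" using ep[OF v] by (simp add: power_mult_distrib)
      also have "\<dots> \<le> a e e * a v v" by (rule a.cauchy_schwarz[OF e v])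
      also have "\<dots> \<le> a e e * (CARD('d) * \<zeta>\<^sup>2 * (H1_norm_vec \<Omega> v)\<^sup>2)"
        using F.a_form_le_H1[of lam \<mu> v] v V(2) pos aee unfolding z2(1) a_def
        by (intro mult_left_mono) auto
      also have "\<dots> = \<alpha>\<^sup>2 * (M * H1_norm_vec \<Omega> v)\<^sup>2"
      proof -
        have "\<alpha>\<^sup>2 = s * \<zeta>\<^sup>2" using z2 by (simp add: s)
        then have eq: "\<alpha>\<^sup>2 * (M * H1_norm_vec \<Omega> v)\<^sup>2 = \<zeta>\<^sup>2 * (s * M\<^sup>2) * (H1_norm_vec \<Omega> v)\<^sup>2"
          by (simp only: power_mult_distrib mult_ac)
        show ?thesis unfolding eq M2 by (simp only: mult_ac)
      qed
      finally show "(b v p)\<^sup>2 \<le> (M * H1_norm_vec \<Omega> v)\<^sup>2" using pos by simp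
      show "0 \<le> M * H1_norm_vec \<Omega> v" using \<open>M \<ge> 0\<close> by (simp add: H1_norm_vec_def)
    qed
    then have le: "\<gamma> * L2_norm \<Omega> p \<le> M + \<xi> * h * L2_norm \<Omega> (grad \<Omega> p)"
      using weak_inf_sup_bound[OF inf_sup p \<open>M \<ge> 0\<close>] by (simp add: b_def)
    let ?G = "\<xi> * h * L2_norm \<Omega> (grad \<Omega> p)"
    have "0 \<le> \<gamma> * L2_norm \<Omega> p" using pos by (simp add: L2_norm_def L2_inner_nonneg)
    with le have "(\<gamma> * L2_norm \<Omega> p)\<^sup>2 \<le> (M + ?G)\<^sup>2" by (intro power_mono)
    also have "\<dots> \<le> 2 * M\<^sup>2 + 2 * ?G\<^sup>2"
      using zero_le_power2[of "M - ?G"] by (simp add: power2_sum power2_diff)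
    finally have "\<gamma>\<^sup>2 * m p p \<le> 2 * M\<^sup>2 + 2 * (\<xi>\<^sup>2 * h\<^sup>2 * g p p)"
      by (simp add: power_mult_distrib L2_norm_power2 m_def g_def)
    \<comment> \<open>After multiplication by \<open>s\<close>, the relation
      \<open>\<eta> = \<delta> * s\<close> turns the gradient term into
      \<open>\<xi>\<^sup>2 / \<delta>\<close> times the stabilization part of \<open>c1\<close>, so
      no power of \<open>h\<close> survives.\<close>
    then have "s * (\<gamma>\<^sup>2 * m p p) \<le> s * (2 * M\<^sup>2 + 2 * (\<xi>\<^sup>2 * h\<^sup>2 * g p p))"
      using \<open>s > 0\<close> by (intro mult_left_mono) auto
    also have "\<dots> = 2 * (s * M\<^sup>2) + 2 * \<xi>\<^sup>2 / \<delta> * (\<eta> * h\<^sup>2 * g p p)"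
      using pos by (simp add: \<eta> algebra_simps)
    also have "\<dots> \<le> 2 * (CARD('d) * a e e) + 2 * \<xi>\<^sup>2 / \<delta> * c1 p p"
      unfolding M2 c1_def using pos g.nonneg[OF p] by (intro add_mono mult_left_mono) auto
    finally have "\<gamma>\<^sup>2 * (s * m p p) \<le> 2 * (CARD('d) * a e e) + 2 * \<xi>\<^sup>2 / \<delta> * c1 p p"
      by (simp add: algebra_simps)
    then have "s * m p p \<le> (2 * (CARD('d) * a e e) + 2 * \<xi>\<^sup>2 / \<delta> * c1 p p) / \<gamma>\<^sup>2"
      using pos by (simp add: le_divide_eq mult.commute)
    then show ?thesis by (simp add: add_divide_distrib algebra_simps)
  qed
  have eq2': "\<alpha> * b w q + (c1 r q + s * m r q) = \<alpha> * b u q + c1 p q" if "q \<in> Q" for q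
    using eq2[OF that] by (simp add: c0_def)
  have coeff: "0 \<le> 2 * \<xi>\<^sup>2 / (\<gamma>\<^sup>2 * \<delta>)" "0 \<le> 2 * CARD('d) / \<gamma>\<^sup>2" using pos by simp_all
  note est = block_triangular_estimate[where X = "2 * \<xi>\<^sup>2 / (\<gamma>\<^sup>2 * \<delta>)" and Y = "2 * CARD('d) / \<gamma>\<^sup>2"
      and s = s and \<alpha> = \<alpha> and b = b and u = u and w = w and p = p and r = r, OF sa sc1 sm \<open>s > 0\<close> b1 cont bound coeff
      up(2) wr(1) up(3) wr(2) eq1 eq2']
  have inner': "inner_inv V Q BD x x = a u u + c0 p p"
    "inner_inv V Q BD (BL (A x)) x = a w u + c0 r p"
    "inner_inv V Q BD (BL (A x)) (BL (A x)) = a w w + c0 r r"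
    unfolding up(1) wr(3) using inner up wr by simp_all
  show "inner_inv V Q BD x x > 0"
  proof -
    have "a u u \<ge> 0" "c0 p p \<ge> 0" using a.nonneg[OF up(2)] c0.nonneg[OF up(3)] by auto
    moreover have "a u u \<noteq> 0 \<or> c0 p p \<noteq> 0"
      using da[OF up(2)] dc0[OF up(3)] x(2) up(1) by auto
    ultimately show ?thesis unfolding inner' by linarith
  qed
  show "inner_inv V Q BD x x \<le> (2 + 2 * \<xi>\<^sup>2 / (\<gamma>\<^sup>2 * \<delta>) + 2 * (2 * CARD('d) / \<gamma>\<^sup>2)) * inner_inv V Q BD (BL (A x)) x"
    unfolding inner' c0_def by (rule est(1))
  show "inner_inv V Q BD (BL (A x)) (BL (A x)) \<le> 4 * inner_inv V Q BD x x"
    unfolding inner' c0_def by (rule est(2))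
qed

theorem theorem4:
  fixes \<gamma> \<xi> \<delta> :: real
  assumes "CARD('d::finite) \<in> {2, 3}"
    and "\<gamma> > 0" and "\<xi> \<ge> 0" and "\<delta> > 0"
  shows "\<exists>\<Sigma> \<Upsilon>. \<Sigma> > 0 \<and> \<Upsilon> > 0 \<and>
    (\<forall>(\<Omega> :: (real^'d) set) \<T> el V Q lam \<mu> \<alpha> K h \<tau> \<zeta> \<eta> A BL BD.
       open \<Omega> \<longrightarrow> bounded \<Omega> \<longrightarrow> lipschitz_boundary \<Omega> \<longrightarrow>
       lam \<ge> 0 \<longrightarrow> \<mu> > 0 \<longrightarrow> \<alpha> > 0 \<longrightarrow> K > 0 \<longrightarrow> h > 0 \<longrightarrow> \<tau> > 0 \<longrightarrow>
       mesh \<Omega> \<T> h \<longrightarrow>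
       V = displacement_space el \<Omega> \<T> \<longrightarrow>
       Q = pressure_space \<Omega> \<T> \<longrightarrow>
       weak_inf_sup \<Omega> V Q h \<gamma> \<xi> \<longrightarrow>
       \<zeta> = sqrt (lam + 2 * \<mu> / real CARD('d)) \<longrightarrow>
       \<eta> = \<delta> * (\<alpha>\<^sup>2 / \<zeta>\<^sup>2) \<longrightarrow>
       A = biot_op \<Omega> V Q lam \<mu> \<alpha> K h \<tau> \<eta> \<longrightarrow>
       BL = inv_into (V \<times> Q) (lower_op \<Omega> V Q lam \<mu> \<alpha> K h \<tau> \<eta> (\<alpha>\<^sup>2 / \<zeta>\<^sup>2)) \<longrightarrow>
       BD = inv_into (V \<times> Q) (diag_op \<Omega> V Q lam \<mu> K h \<tau> \<eta> (\<alpha>\<^sup>2 / \<zeta>\<^sup>2)) \<longrightarrow>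
       (\<forall>x\<in>V \<times> Q. x \<noteq> (\<lambda>_. 0, \<lambda>_. 0) \<longrightarrow>
          \<Sigma> \<le> inner_inv V Q BD (BL (A x)) x / inner_inv V Q BD x x \<and>
          norm_inv V Q BD (BL (A x)) / norm_inv V Q BD x \<le> \<Upsilon>))"
proof -
  \<comment> \<open>\<open>C\<close> is fixed before domain, mesh and physical parameters are
    introduced, and contains only the dimension, \<open>\<gamma>\<close>, \<open>\<xi>\<close> and
    \<open>\<delta>\<close>; the witnesses are \<open>1 / C\<close> and 2.\<close>
  define C where "C = 2 + 2 * \<xi>\<^sup>2 / (\<gamma>\<^sup>2 * \<delta>) + 2 * (2 * CARD('d) / \<gamma>\<^sup>2)"
  have "C > 0" using assms by (simp add: C_def add_pos_nonneg)
  have "1 / C \<le> inner_inv V Q BD (BL (A x)) x / inner_inv V Q BD x x \<and>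
      norm_inv V Q BD (BL (A x)) / norm_inv V Q BD x \<le> 2"
    if h: "open \<Omega>" "bounded \<Omega>" "lam \<ge> 0" "\<mu> > 0" "\<alpha> > 0" "K > 0" "h > 0" "\<tau> > 0"
      "mesh \<Omega> \<T> h" "V = displacement_space el \<Omega> \<T>" "Q = pressure_space \<Omega> \<T>"
      "weak_inf_sup \<Omega> V Q h \<gamma> \<xi>" "\<zeta> = sqrt (lam + 2 * \<mu> / real CARD('d))"
      "\<eta> = \<delta> * (\<alpha>\<^sup>2 / \<zeta>\<^sup>2)" "A = biot_op \<Omega> V Q lam \<mu> \<alpha> K h \<tau> \<eta>"
      "BL = inv_into (V \<times> Q) (lower_op \<Omega> V Q lam \<mu> \<alpha> K h \<tau> \<eta> (\<alpha>\<^sup>2 / \<zeta>\<^sup>2))"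
      "BD = inv_into (V \<times> Q) (diag_op \<Omega> V Q lam \<mu> K h \<tau> \<eta> (\<alpha>\<^sup>2 / \<zeta>\<^sup>2))"
      "x \<in> V \<times> Q" "x \<noteq> (\<lambda>_. 0, \<lambda>_. 0)"
    for \<Omega> :: "(real^'d) set" and \<T> el V Q lam \<mu> \<alpha> K h \<tau> \<zeta> \<eta> A BL BD x
  proof -
    interpret bounded_domain \<Omega> by unfold_locales fact+
    obtain F where F: "conforming_space \<Omega> F" "V = vector_space_of F"
      using conforming_space_P1[OF h(9)] conforming_space_P1_bubble[OF h(9)] h(10)
      by (cases el) (auto simp: vector_space_of_def)
    have Q: "conforming_space \<Omega> Q"
      using conforming_space_P1[OF h(9)] h(11) by (simp add: pressure_space_def)
    note bounds = biot_preconditioner_bounds[OF F Q h(12) assms(2,4) h(3-8,13) refl h(14-19), folded C_def]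
    \<comment> \<open>Positivity of the denominator, supplied by the first of the bounds, allows the
      product inequality to be divided.\<close>
    have "1 / C \<le> inner_inv V Q BD (BL (A x)) x / inner_inv V Q BD x x"
      using bounds(1,2) \<open>C > 0\<close> by (simp add: field_simps)
    moreover have "norm_inv V Q BD (BL (A x)) \<le> 2 * norm_inv V Q BD x"
      using real_sqrt_le_mono[OF bounds(3)] by (simp add: norm_inv_def real_sqrt_mult)
    then have "norm_inv V Q BD (BL (A x)) / norm_inv V Q BD x \<le> 2"
      using bounds(1) by (simp add: norm_inv_def divide_le_eq)
    ultimately show ?thesis ..
  qed
  then show ?thesis
    using \<open>C > 0\<close> by (intro exI[of _ "1 / C"] exI[of _ 2]) simp
qed

end
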